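(* Let $n\ge2$ and let $t$ be a positive integer. Define pairs $(X^{(m)},W^{(m)})$ on the unit spheres $S^{m-1}\subseteq\mathbb{R}^m$, $m=2,\dots,n$, recursively as follows. $X^{(2)}\subseteq S^1$ is the set of vertices of the regular polygon with $2(t+1)$ sides inscribed in $S^1$ having $(1,0)$ as a vertex, with all weights equal to $\frac{\pi}{t+1}$. For $m\ge3$, let $(Z^{(m)},W_{Z}^{(m)})$ be the Gauss–Jacobi quadrature rule with $t+1$ nodes on $[-1,1]$ for the weight function $(1-s^2)^{\frac{m-3}{2}}$, and put \[X^{(m)}=\left\{\left(z,\sqrt{1-z^2}\,y\right):(z,y)\in Z^{(m)}\times X^{(m-1)}\right\},\qquad W^{(m)}\left(z,\sqrt{1-z^2}\,y\right)=W_Z^{(m)}(z)\,W^{(m-1)}(y).\] Then $(X^{(n)},W^{(n)})$ is a cubature rule of algebraic degree $2t$ for $\mu$ on the sphere $S=S^{n-1}\subseteq\mathbb{R}^n$ consisting of $2(t+1)^{n-1}$ points.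
   Context: $\mu$ is the $(n-1)$-dimensional area measure on the unit sphere $S\subseteq\mathbb{R}^n$. A cubature rule of algebraic degree $2t$ for $\mu$ is a pair $(X,W)$ with $X\subseteq S$ finite and $W:X\to\mathbb{R}_{>0}$ such that $\int_S f\,d\mu=\sum_{x\in X}W(x)f(x)$ for every homogeneous polynomial $f\in\mathbb{R}[x_1,\dots,x_n]$ of degree $2t$. The Gauss–Jacobi quadrature rule with $N$ nodes for the weight $w(s)=(1-s^2)^{\beta}$, $\beta>-1$, has as nodes the $N$ roots of the Jacobi polynomial $P_N^{(\beta,\beta)}$ and has the unique positive weights for which $\int_{-1}^1 p(s)w(s)\,ds=\sum_z W_Z(z)p(z)$ for all univariate polynomials $p$ of degree at most $2N-1$. *)

theory Defs
  imports "HOL-Analysis.Analysis" "HOL-Computational_Algebra.Polynomial"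
begin

text \<open>
  Since the construction runs through all dimensions up to an arbitrary \<open>n\<close>, points of
  \<open>\<real>\<^sup>n\<close> are the extensional functions in \<^term>\<open>{..<n} \<rightarrow>\<^sub>E (UNIV :: real set)\<close>. This is the
  underlying space of the product measure \<^term>\<open>\<Pi>\<^sub>M i\<in>{..<n}. (lborel :: real measure)\<close>, which is
  \<open>n\<close>-dimensional Lebesgue measure.
\<close>

definition unit_sphere :: "nat \<Rightarrow> (nat \<Rightarrow> real) set" where
  "unit_sphere n = {x \<in> {..<n} \<rightarrow>\<^sub>E UNIV. L2_set x {..<n} = 1}"

definition punctured_ball :: "nat \<Rightarrow> (nat \<Rightarrow> real) set" where
  "punctured_ball n = {x \<in> {..<n} \<rightarrow>\<^sub>E UNIV. 0 < L2_set x {..<n} \<and> L2_set x {..<n} \<le> 1}"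

definition radial_projection :: "nat \<Rightarrow> (nat \<Rightarrow> real) \<Rightarrow> nat \<Rightarrow> real" where
  "radial_projection n x = (\<lambda>i\<in>{..<n}. x i / L2_set x {..<n})"

text \<open>
  The \<open>(n-1)\<close>-dimensional area measure on the unit sphere, as it is introduced with polar
  coordinates: the area of \<open>A\<close> is \<open>n\<close> times the Lebesgue measure of the cone
  \<open>{r x | 0 < r \<le> 1, x \<in> A}\<close> (see \<open>emeasure_sphere_area\<close>). There is no normalisation to
  total mass 1; for \<open>n = 2\<close> this is arc length, of total mass \<open>2\<pi>\<close>.
\<close>

definition sphere_area :: "nat \<Rightarrow> (nat \<Rightarrow> real) measure" where
  "sphere_area n =
     distr (scale_measure (of_nat n) (restrict_space (\<Pi>\<^sub>M i\<in>{..<n}. lborel) (punctured_ball n)))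
       (restrict_space (\<Pi>\<^sub>M i\<in>{..<n}. borel) (unit_sphere n))
       (radial_projection n)"

lemma space_sphere_area: "space (sphere_area n) = unit_sphere n"
  by (auto simp: sphere_area_def space_restrict_space space_PiM unit_sphere_def)

lemma L2_set_measurable [measurable]:
  "(\<lambda>x. L2_set x {..<n}) \<in> borel_measurable (\<Pi>\<^sub>M i\<in>{..<n}. lborel)"
  unfolding L2_set_def by measurable

lemma sets_punctured_ball [measurable]:
  "punctured_ball n \<in> sets (\<Pi>\<^sub>M i\<in>{..<n}. lborel)"
proof -
  have "punctured_ball n = {x \<in> space (\<Pi>\<^sub>M i\<in>{..<n}. lborel).
      0 < L2_set x {..<n} \<and> L2_set x {..<n} \<le> 1}"
    by (auto simp: punctured_ball_def space_PiM)
  also have "\<dots> \<in> sets (\<Pi>\<^sub>M i\<in>{..<n}. lborel)"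
    by measurable
  finally show ?thesis .
qed

lemma radial_projection_in_sphere:
  assumes "x \<in> punctured_ball n"
  shows "radial_projection n x \<in> unit_sphere n"
proof -
  let ?r = "L2_set x {..<n}"
  have r: "?r > 0" using assms by (simp add: punctured_ball_def)
  have "L2_set (radial_projection n x) {..<n} = L2_set (\<lambda>i. (1 / ?r) * x i) {..<n}"
    by (rule L2_set_cong) (auto simp: radial_projection_def)
  also have "\<dots> = (1 / ?r) * ?r"
    using r by (subst L2_set_right_distrib) auto
  finally show ?thesis
    using r by (auto simp: unit_sphere_def radial_projection_def)
qed

lemma radial_projection_measurable:
  "radial_projection n \<in> measurable
     (scale_measure (of_nat n) (restrict_space (\<Pi>\<^sub>M i\<in>{..<n}. lborel) (punctured_ball n)))
     (restrict_space (\<Pi>\<^sub>M i\<in>{..<n}. borel) (unit_sphere n))"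
proof -
  have "radial_projection n \<in> measurable (\<Pi>\<^sub>M i\<in>{..<n}. lborel) (\<Pi>\<^sub>M i\<in>{..<n}. borel)"
    unfolding radial_projection_def by (rule measurable_restrict) measurable
  then have "radial_projection n \<in> measurable
      (restrict_space (\<Pi>\<^sub>M i\<in>{..<n}. lborel) (punctured_ball n)) (\<Pi>\<^sub>M i\<in>{..<n}. borel)"
    by (rule measurable_restrict_space1)
  then have "radial_projection n \<in> measurable
      (restrict_space (\<Pi>\<^sub>M i\<in>{..<n}. lborel) (punctured_ball n))
      (restrict_space (\<Pi>\<^sub>M i\<in>{..<n}. borel) (unit_sphere n))"
    by (intro measurable_restrict_space2)
       (auto simp: space_restrict_space radial_projection_in_sphere)
  then show ?thesis
    by (simp cong: measurable_cong_sets)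
qed

lemma emeasure_sphere_area:
  assumes "A \<in> sets (sphere_area n)"
  shows "emeasure (sphere_area n) A =
    of_nat n * emeasure (\<Pi>\<^sub>M i\<in>{..<n}. lborel) {x \<in> punctured_ball n. radial_projection n x \<in> A}"
proof -
  have sp: "punctured_ball n \<inter> space (\<Pi>\<^sub>M i\<in>{..<n}. lborel) = punctured_ball n"
    by (auto simp: punctured_ball_def space_PiM)
  have "emeasure (sphere_area n) A = of_nat n *
      emeasure (restrict_space (\<Pi>\<^sub>M i\<in>{..<n}. lborel) (punctured_ball n))
        (radial_projection n -` A \<inter> punctured_ball n)"
    using assms unfolding sphere_area_def
    by (subst emeasure_distr) (auto simp: radial_projection_measurable space_restrict_space sp space_scale_measure)
  also have "\<dots> = of_nat n * emeasure (\<Pi>\<^sub>M i\<in>{..<n}. lborel)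
      (radial_projection n -` A \<inter> punctured_ball n)"
    by (subst emeasure_restrict_space) (auto simp: sp)
  also have "radial_projection n -` A \<inter> punctured_ball n =
      {x \<in> punctured_ball n. radial_projection n x \<in> A}"
    by auto
  finally show ?thesis .
qed

text \<open>
  A real homogeneous polynomial in \<open>n\<close> variables, as a function on \<open>\<real>\<^sup>n\<close>. Exponents in a
  monomial of degree \<open>d\<close> are at most \<open>d\<close>, so the sum runs over all monomials of degree \<open>d\<close>.
\<close>

definition homogeneous_polynomial :: "nat \<Rightarrow> nat \<Rightarrow> ((nat \<Rightarrow> real) \<Rightarrow> real) \<Rightarrow> bool" where
  "homogeneous_polynomial n d f \<longleftrightarrow>
     (\<exists>c :: (nat \<Rightarrow> nat) \<Rightarrow> real. \<forall>x.
        f x = (\<Sum>a | a \<in> {..<n} \<rightarrow>\<^sub>E {..d} \<and> (\<Sum>i<n. a i) = d. c a * (\<Prod>i<n. x i ^ a i)))"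

definition cubature_rule ::
    "nat \<Rightarrow> nat \<Rightarrow> (nat \<Rightarrow> real) set \<Rightarrow> ((nat \<Rightarrow> real) \<Rightarrow> real) \<Rightarrow> bool" where
  "cubature_rule n d X W \<longleftrightarrow>
     X \<subseteq> unit_sphere n \<and> finite X \<and> (\<forall>x\<in>X. W x > 0) \<and>
     (\<forall>f. homogeneous_polynomial n d f \<longrightarrow>
        (\<integral>x. f x \<partial>sphere_area n) = (\<Sum>x\<in>X. W x * f x))"

text \<open>
  The Jacobi polynomial \<open>P\<^sub>N\<close> with parameters \<open>(\<alpha>, \<beta>)\<close>, in the standard normalisation
  (value \<open>(N + \<alpha>) gchoose N\<close> at 1), given by the sum over \<open>k \<le> N\<close> of
  \<open>((N + \<alpha>) gchoose (N - k)) ((N + \<beta>) gchoose k) ((s - 1) / 2)^k ((s + 1) / 2)^(N - k)\<close>.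
\<close>

definition jacobi_poly :: "nat \<Rightarrow> real \<Rightarrow> real \<Rightarrow> real poly" where
  "jacobi_poly N \<alpha> \<beta> =
     (\<Sum>k\<le>N. smult (((real N + \<alpha>) gchoose (N - k)) * ((real N + \<beta>) gchoose k))
                ([:-1/2, 1/2:] ^ k * [:1/2, 1/2:] ^ (N - k)))"

definition gauss_jacobi_nodes :: "nat \<Rightarrow> real \<Rightarrow> real set" where
  "gauss_jacobi_nodes N \<beta> = {z. poly (jacobi_poly N \<beta> \<beta>) z = 0}"

text \<open>Extensionality only makes the weight function unique off the nodes.\<close>

definition gauss_jacobi_weight :: "nat \<Rightarrow> real \<Rightarrow> real \<Rightarrow> real" where
  "gauss_jacobi_weight N \<beta> =
     (THE W. W \<in> extensional (gauss_jacobi_nodes N \<beta>) \<and>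
        (\<forall>z\<in>gauss_jacobi_nodes N \<beta>. W z > 0) \<and>
        (\<forall>p :: real poly. degree p \<le> 2 * N - 1 \<longrightarrow>
           (LBINT s:{-1..1}. poly p s * (1 - s\<^sup>2) powr \<beta>) =
           (\<Sum>z\<in>gauss_jacobi_nodes N \<beta>. W z * poly p z)))"

definition polygon_vertices :: "nat \<Rightarrow> (nat \<Rightarrow> real) set" where
  "polygon_vertices k =
     (\<lambda>j. \<lambda>i\<in>{..<2}. if i = 0 then cos (2 * pi * real j / real k)
                             else sin (2 * pi * real j / real k)) ` {..<k}"

text \<open>The point \<open>(z, sqrt (1 - z\<^sup>2) y)\<close> of \<open>\<real>\<^sup>m\<close>, for \<open>y\<close> in \<open>\<real>\<^sup>m\<^sup>-\<^sup>1\<close>.\<close>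

definition lift_point :: "nat \<Rightarrow> real \<Rightarrow> (nat \<Rightarrow> real) \<Rightarrow> nat \<Rightarrow> real" where
  "lift_point m z y = (\<lambda>i\<in>{..<m}. if i = 0 then z else sqrt (1 - z\<^sup>2) * y (i - 1))"

text \<open>Only dimensions \<open>m \<ge> 2\<close> are meaningful below.\<close>

fun product_nodes :: "nat \<Rightarrow> nat \<Rightarrow> (nat \<Rightarrow> real) set" where
  "product_nodes t m =
     (if m \<le> 2 then polygon_vertices (2 * (t + 1))
      else {lift_point m z y | z y.
              z \<in> gauss_jacobi_nodes (t + 1) ((real m - 3) / 2) \<and> y \<in> product_nodes t (m - 1)})"

text \<open>
  The definite description renders the implicit definition of the weight at
  \<open>(z, sqrt (1 - z\<^sup>2) y)\<close> as the product of the weights at \<open>z\<close> and at \<open>y\<close>.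
\<close>

fun product_weight :: "nat \<Rightarrow> nat \<Rightarrow> (nat \<Rightarrow> real) \<Rightarrow> real" where
  "product_weight t m x =
     (if m \<le> 2 then pi / real (t + 1)
      else (THE w. \<exists>z\<in>gauss_jacobi_nodes (t + 1) ((real m - 3) / 2). \<exists>y\<in>product_nodes t (m - 1).
              x = lift_point m z y \<and>
              w = gauss_jacobi_weight (t + 1) ((real m - 3) / 2) z * product_weight t (m - 1) y))"

declare product_nodes.simps [simp del] product_weight.simps [simp del]

end

theory Submission
  imports Defs "HOL-Probability.Distributions"
begin

text \<open>
  It suffices to integrate monomials \<open>x\<^sup>a\<close>. Comparing with the Gaussian integral over \<open>\<real>\<^sup>n\<close>, which
  factorises, gives \<open>\<integral>\<^sub>S x\<^sup>a = 2 (\<Prod>i. \<Gamma>((a\<^sub>i + 1) / 2)) / \<Gamma>((n + \<bar>a\<bar>) / 2)\<close> if all \<open>a\<^sub>i\<close> are even, and 0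
  otherwise. Hence the moments in dimension \<open>m\<close> arise from those in dimension \<open>m - 1\<close> through the
  Beta integrals \<open>\<integral> s\<^sup>k (1 - s\<^sup>2)\<^sup>e\<^sup>/\<^sup>2 (1 - s\<^sup>2)\<^sup>(\<^sup>m\<^sup>-\<^sup>3\<^sup>)\<^sup>/\<^sup>2 ds\<close>, where \<open>e\<close> is the degree in the remaining
  variables. If \<open>e\<close> is odd, both the moment and the lower-dimensional sum vanish; if \<open>e\<close> is even, the
  Gauss-Jacobi rule is exact, since \<open>s\<^sup>k (1 - s\<^sup>2)\<^sup>e\<^sup>/\<^sup>2\<close> is a polynomial of degree at most \<open>2t + 1\<close>. So
  exactness for all monomials of degree at most \<open>2t + 1\<close> propagates from the polygon to all dimensions.
\<close>

subsection \<open>Monomial integrals over the sphere\<close>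

text \<open>The area measure is given by cone volumes, which is not adapted to slicing the sphere at
  a fixed first coordinate. Closed Gamma formulas take the place of slicing: the polygon and the
  step up in dimension only have to reproduce quotients of Gamma values. Splitting off the first
  variable leaves monomials of every smaller degree in the others, so homogeneity of degree
  \<open>2 * t\<close> would not survive the induction. The bound \<open>2 * t + 1\<close> is common
  to both ingredients: \<open>t + 1\<close> Gauss nodes are exact up to degree
  \<open>2 * (t + 1) - 1\<close>, and summation over \<open>2 * (t + 1)\<close> equally spaced
  angles cancels all nonzero frequencies up to the same number. The nodes are roots of an explicit
  sum and the weights are definite descriptions, so orthogonality, simplicity and location of the
  roots, and existence and uniqueness of the weights have to be derived. That the nodes lie strictly
  inside the interval also keeps the lifted points distinct, on which the cardinality and the
  meaning of \<open>product_weight\<close> depend.\<close>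

text \<open>The moments of the unnormalised weight \<open>exp (- x\<^sup>2)\<close> on the whole
  line, see \<open>gaussian_moment_line\<close>; the zeroth is \<open>sqrt pi\<close>.\<close>

definition gaussian_moment :: "nat \<Rightarrow> real" where
  "gaussian_moment k = (if even k then Gamma ((real k + 1) / 2) else 0)"

text \<open>Translates the factorial form of the even Gaussian moments, so that even and odd
  exponents share one Gamma formula in \<open>gaussian_moment_half_line\<close>.\<close>

lemma Gamma_half_nat:
  "Gamma (real j + 1 / 2) = sqrt pi * (fact (2 * j) / (2 ^ (2 * j) * fact j))"
proof (induction j)
  case 0
  then show ?case by (simp add: Gamma_one_half_real)
next
  case (Suc j)
  have "Gamma (real (Suc j) + 1 / 2) = Gamma ((real j + 1 / 2) + 1)"
    by (simp add: add_ac)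
  also have "\<dots> = (real j + 1 / 2) * (sqrt pi * (fact (2 * j) / (2 ^ (2 * j) * fact j)))"
    unfolding Suc.IH [symmetric] by (rule Gamma_plus1) (auto dest: nonpos_Ints_nonpos)
  also have "(real j + 1 / 2) * (sqrt pi * (fact (2 * j) / (2 ^ (2 * j) * fact j))) =
      sqrt pi * (fact (2 * Suc j) / (2 ^ (2 * Suc j) * fact (Suc j)))"
    by (simp add: divide_simps) algebra
  finally show ?case .
qed

lemma gaussian_moment_half_line:
  "has_bochner_integral lborel (\<lambda>r::real. indicator {0..} r *\<^sub>R (exp (- r\<^sup>2) * r ^ k))
     (Gamma ((real k + 1) / 2) / 2)"
proof (cases "even k")
  case True
  then obtain j where k: "k = 2 * j" by (elim evenE)
  have "Gamma ((real k + 1) / 2) = sqrt pi * (fact (2 * j) / (2 ^ (2 * j) * fact j))"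
    by (subst Gamma_half_nat [symmetric]) (simp add: k add_divide_distrib)
  then show ?thesis
    using gaussian_moment_even_pos [of j] by (simp add: k mult_ac)
next
  case False
  then obtain j where k: "k = 2 * j + 1" by (elim oddE)
  have "Gamma ((real k + 1) / 2) = fact j"
    by (subst Gamma_fact [symmetric]) (simp add: k add_divide_distrib)
  then show ?thesis
    using gaussian_moment_odd_pos [of j] by (simp add: k)
qed

lemma gaussian_moment_line:
  "has_bochner_integral lborel (\<lambda>x::real. exp (- x\<^sup>2) * x ^ k) (gaussian_moment k)"
proof (cases "even k")
  case True
  then show ?thesis
    using has_bochner_integral_even_function [OF gaussian_moment_half_line [of k]]
    by (simp add: gaussian_moment_def)
next
  case False
  then show ?thesis
    using has_bochner_integral_odd_function [OF gaussian_moment_half_line [of k]]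
    by (simp add: gaussian_moment_def)
qed

section \<open>Dilations of Lebesgue measure\<close>

lemma emeasure_lborel_mult_vimage:
  fixes c :: real
  assumes c: "c > 0" and A: "A \<in> sets borel"
  shows "ennreal c * emeasure lborel {x. c * x \<in> A} = emeasure lborel A"
proof -
  have "emeasure lborel {x. c * x \<in> A} = emeasure (distr lborel borel ((*) c)) A"
    using A by (subst emeasure_distr) (auto simp: vimage_def)
  also have "\<dots> = ennreal (inverse c) * emeasure lborel A"
    using A c by (subst lborel_distr_mult) (auto simp: emeasure_density_const)
  finally show ?thesis
    using c by (simp add: mult.assoc [symmetric] ennreal_mult'' [symmetric])
qed

text \<open>A sigma-finite product measure is determined by its values on boxes, and a dilation acts
  on each side of a box separately, contributing one factor \<open>c\<close> per coordinate.\<close>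

lemma PiM_lborel_dilation:
  fixes c :: real
  assumes c: "c > 0"
  shows "density (distr (\<Pi>\<^sub>M i\<in>{..<n}. lborel) (\<Pi>\<^sub>M i\<in>{..<n}. lborel) (\<lambda>x. \<lambda>i\<in>{..<n}. c * x i))
           (\<lambda>_. ennreal (c ^ n)) = (\<Pi>\<^sub>M i\<in>{..<n}. lborel)" (is "density (distr ?\<mu> _ ?T) _ = _")
proof -
  interpret product_sigma_finite "\<lambda>_::nat. lborel :: real measure" ..
  have T: "?T \<in> measurable ?\<mu> ?\<mu>" by measurable
  show ?thesis
  proof (rule PiM_eqI)
    fix A :: "nat \<Rightarrow> real set"
    assume A: "\<And>i. i \<in> {..<n} \<Longrightarrow> A i \<in> sets lborel"
    have PA: "Pi\<^sub>E {..<n} A \<in> sets ?\<mu>" using A by (intro sets_PiM_I_finite) auto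
    have meas: "{x. c * x \<in> A i} \<in> sets borel" if "i < n" for i
      using measurable_sets[of "(*) c" borel borel "A i"] A[of i] that by (auto simp: vimage_def)
    have "?T -` (Pi\<^sub>E {..<n} A) \<inter> space ?\<mu> = (\<Pi>\<^sub>E i\<in>{..<n}. {x. c * x \<in> A i})"
    proof (rule set_eqI)
      fix x
      have "x \<in> ?T -` (Pi\<^sub>E {..<n} A) \<inter> space ?\<mu> \<longleftrightarrow> (\<forall>i\<in>{..<n}. c * x i \<in> A i) \<and> x \<in> extensional {..<n}"
        unfolding vimage_def Int_iff mem_Collect_eq restrict_PiE_iff space_PiM PiE_UNIV_domain
        by (simp add: PiE_def)
      also have "\<dots> \<longleftrightarrow> x \<in> (\<Pi>\<^sub>E i\<in>{..<n}. {x. c * x \<in> A i})"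
        unfolding PiE_def Pi_def by blast
      finally show "x \<in> ?T -` (Pi\<^sub>E {..<n} A) \<inter> space ?\<mu> \<longleftrightarrow> x \<in> (\<Pi>\<^sub>E i\<in>{..<n}. {x. c * x \<in> A i})" .
    qed
    moreover have "emeasure (density (distr ?\<mu> ?\<mu> ?T) (\<lambda>_. ennreal (c ^ n))) (Pi\<^sub>E {..<n} A) =
        ennreal (c ^ n) * emeasure (distr ?\<mu> ?\<mu> ?T) (Pi\<^sub>E {..<n} A)"
      using PA by (intro emeasure_density_const) auto
    ultimately have "emeasure (density (distr ?\<mu> ?\<mu> ?T) (\<lambda>_. ennreal (c ^ n))) (Pi\<^sub>E {..<n} A) =
        ennreal (c ^ n) * emeasure ?\<mu> (\<Pi>\<^sub>E i\<in>{..<n}. {x. c * x \<in> A i})"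
      using emeasure_distr [OF T PA] by simp
    also have "\<dots> = (\<Prod>i<n. ennreal c) * (\<Prod>i<n. emeasure lborel {x. c * x \<in> A i})"
      using c meas by (subst emeasure_PiM) (simp_all add: ennreal_power)
    also have "\<dots> = (\<Prod>i<n. emeasure lborel (A i))"
      unfolding prod.distrib [symmetric]
      using c A by (intro prod.cong) (auto simp: emeasure_lborel_mult_vimage)
    finally show "emeasure (density (distr ?\<mu> ?\<mu> ?T) (\<lambda>_. ennreal (c ^ n))) (Pi\<^sub>E {..<n} A) =
        (\<Prod>i<n. emeasure lborel (A i))" .
  qed auto
qed

lemma integral_PiM_lborel_dilation:
  fixes c :: real and f :: "(nat \<Rightarrow> real) \<Rightarrow> real"
  assumes c: "c > 0" and f [measurable]: "f \<in> borel_measurable (\<Pi>\<^sub>M i\<in>{..<n}. lborel)"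
  shows "(\<integral>x. f x \<partial>(\<Pi>\<^sub>M i\<in>{..<n}. lborel)) =
         c ^ n * (\<integral>x. f (\<lambda>i\<in>{..<n}. c * x i) \<partial>(\<Pi>\<^sub>M i\<in>{..<n}. lborel))"
proof -
  have [measurable]: "(\<lambda>x. \<lambda>i\<in>{..<n}. c * x i) \<in>
      measurable (\<Pi>\<^sub>M i\<in>{..<n}. lborel) (\<Pi>\<^sub>M i\<in>{..<n}. lborel)" by measurable
  show ?thesis
    using c by (subst PiM_lborel_dilation [OF c, symmetric])
      (simp add: integral_density integral_distr)
qed

section \<open>Polar coordinates\<close>

lemma sphere_integral_eq:
  fixes f :: "(nat \<Rightarrow> real) \<Rightarrow> real"
  assumes f [measurable]: "f \<in> borel_measurable (\<Pi>\<^sub>M i\<in>{..<n}. borel)"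
  shows "(\<integral>x. f x \<partial>sphere_area n) =
         real n * (\<integral>x. indicator (punctured_ball n) x * f (radial_projection n x) \<partial>(\<Pi>\<^sub>M i\<in>{..<n}. lborel))"
proof -
  let ?\<mu> = "\<Pi>\<^sub>M i\<in>{..<n}. lborel :: real measure"
  \<comment> \<open>Written as a constant density, the scaling becomes accessible to
    \<open>integral_density\<close>.\<close>
  have "scale_measure (of_nat n) (restrict_space ?\<mu> (punctured_ball n)) =
     density (restrict_space ?\<mu> (punctured_ball n)) (\<lambda>_. ennreal (real n))"
    by (intro measure_eqI) (auto simp: emeasure_density_const ennreal_of_nat_eq_real_of_nat)
  moreover have m0: "(\<lambda>x. f (radial_projection n x)) \<in> borel_measurable ?\<mu>"
  proof -
    have [measurable]: "radial_projection n \<in> measurable ?\<mu> (\<Pi>\<^sub>M i\<in>{..<n}. borel)"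
      unfolding radial_projection_def by (rule measurable_restrict) measurable
    show ?thesis by measurable
  qed
  moreover have m: "(\<lambda>x. f (radial_projection n x)) \<in> borel_measurable (restrict_space ?\<mu> (punctured_ball n))"
    using m0 by (rule measurable_restrict_space1)
  moreover have "f \<in> borel_measurable (restrict_space (\<Pi>\<^sub>M i\<in>{..<n}. borel) (unit_sphere n))"
    by (rule measurable_restrict_space1) measurable
  ultimately show ?thesis
    unfolding sphere_area_def
    using radial_projection_measurable[of n]
    by (simp add: integral_distr integral_density integral_restrict_space)
qed

text \<open>
  This is \<open>- d/dr (r\<^sup>d exp (- r\<^sup>2))\<close>, so that its integral over \<open>[\<rho>, \<infinity>)\<close> recovers \<open>\<rho>\<^sup>d exp (- \<rho>\<^sup>2)\<close>; the
  truncated exponent \<open>d - 1\<close> is harmless because of the factor \<open>d\<close>.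
\<close>

definition radial_kernel :: "nat \<Rightarrow> real \<Rightarrow> real" where
  "radial_kernel d r = (2 * r ^ (d + 1) - real d * r ^ (d - 1)) * exp (- r\<^sup>2)"

lemma radial_kernel_measurable [measurable]: "radial_kernel d \<in> borel_measurable borel"
  unfolding radial_kernel_def by measurable

text \<open>Both terms are half-line Gaussian moments. The functional equation turns the first into
  \<open>(n + d) / 2\<close> times the same Gamma value that the second carries with
  \<open>d / 2\<close>. The remaining \<open>n\<close> is the factor by which
  \<open>sphere_area\<close> scales the cone volume.\<close>

lemma radial_kernel_moment:
  assumes "n + d > 0"
  shows "has_bochner_integral lborel (\<lambda>r. indicator {0..} r *\<^sub>R (r ^ n * radial_kernel d r))
     (real n / 2 * Gamma (real (n + d) / 2))"
proof -
  have "has_bochner_integral lborel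
      (\<lambda>r. 2 * (indicator {0..} r *\<^sub>R (exp (- r\<^sup>2) * r ^ (n + d + 1))) -
            real d * (indicator {0..} r *\<^sub>R (exp (- r\<^sup>2) * r ^ (n + d - 1))))
      (2 * (Gamma ((real (n + d + 1) + 1) / 2) / 2) - real d * (Gamma ((real (n + d - 1) + 1) / 2) / 2))"
    by (intro has_bochner_integral_diff has_bochner_integral_mult_right gaussian_moment_half_line)
  also have "(\<lambda>r. 2 * (indicator {0..} r *\<^sub>R (exp (- r\<^sup>2) * r ^ (n + d + 1))) -
            real d * (indicator {0..} r *\<^sub>R (exp (- r\<^sup>2) * r ^ (n + d - 1)))) =
         (\<lambda>r. indicator {0..} r *\<^sub>R (r ^ n * radial_kernel d r))"
    by (rule ext, cases d) (auto simp: radial_kernel_def power_add algebra_simps)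
  also have "2 * (Gamma ((real (n + d + 1) + 1) / 2) / 2) = real (n + d) / 2 * Gamma (real (n + d) / 2)"
    using Gamma_plus1[of "real (n + d) / 2"] assms nonpos_Ints_nonpos[of "real (n + d) / 2"]
    by (force simp: add_divide_distrib add_ac)
  also have "real (n + d - 1) + 1 = real (n + d)"
    using assms by (simp add: of_nat_diff Suc_le_eq)
  also have "real (n + d) / 2 * Gamma (real (n + d) / 2) - real d * (Gamma (real (n + d) / 2) / 2) =
      real n / 2 * Gamma (real (n + d) / 2)"
    by (simp add: field_simps)
  finally show ?thesis .
qed

text \<open>Includes \<open>n = d = 0\<close>, which the moment formula excludes;
  \<open>radial_kernel_tail\<close> uses the case \<open>n = 0\<close> for every
  \<open>d\<close>.\<close>

lemma radial_kernel_integrable: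
  "integrable lborel (\<lambda>r. indicator {0..} r *\<^sub>R (r ^ n * radial_kernel d r))"
proof (cases "n + d > 0")
  case True
  then show ?thesis using radial_kernel_moment by (simp add: has_bochner_integral_iff)
next
  case False
  then have "(\<lambda>r. indicator {0..} r *\<^sub>R (r ^ n * radial_kernel d r)) =
     (\<lambda>r. 2 * (indicator {0..} r *\<^sub>R (exp (- r\<^sup>2) * r ^ 1)))"
    by (auto simp: radial_kernel_def)
  with gaussian_moment_half_line[of 1] show ?thesis
    by (auto simp: has_bochner_integral_iff)
qed

lemma radial_kernel_tail:
  assumes "\<rho> > 0"
  shows "(\<integral>r. indicator {\<rho>..} r * radial_kernel d r \<partial>lborel) = \<rho> ^ d * exp (- \<rho>\<^sup>2)"
proof -
  let ?F = "\<lambda>r::real. - (r ^ d * exp (- r\<^sup>2))"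
  have "integrable lborel (\<lambda>r. indicator {\<rho><..} r *\<^sub>R (indicator {0..} r *\<^sub>R (r ^ 0 * radial_kernel d r)))"
    by (rule integrable_mult_indicator [OF _ radial_kernel_integrable]) auto
  also have "(\<lambda>r. indicator {\<rho><..} r *\<^sub>R (indicator {0..} r *\<^sub>R (r ^ 0 * radial_kernel d r))) =
      (\<lambda>r. indicator {\<rho><..} r *\<^sub>R radial_kernel d r)"
    using assms by (auto simp: indicator_def fun_eq_iff)
  finally have int: "set_integrable lborel {\<rho><..} (radial_kernel d)"
    by (simp add: set_integrable_def)
  have "(LBINT r=ereal \<rho>..\<infinity>. radial_kernel d r) = 0 - ?F \<rho>"
  proof (rule interval_integral_FTC_integrable)
    fix x
    have "(?F has_real_derivative radial_kernel d x) (at x)"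
      unfolding radial_kernel_def
      by (auto intro!: derivative_eq_intros simp: algebra_simps)
    then show "(?F has_vector_derivative radial_kernel d x) (at x)"
      by (simp add: has_real_derivative_iff_has_vector_derivative)
    show "isCont (radial_kernel d) x"
      unfolding radial_kernel_def by (intro continuous_intros)
  next
    show "set_integrable lborel (einterval (ereal \<rho>) \<infinity>) (radial_kernel d)"
      using int by (simp add: einterval_def greaterThan_def)
    have "(?F \<longlongrightarrow> ?F \<rho>) (at_right \<rho>)"
      by (intro tendsto_intros)
    then show "((?F \<circ> real_of_ereal) \<longlongrightarrow> ?F \<rho>) (at_right (ereal \<rho>))"
      by (simp add: ereal_tendsto_simps)
    \<comment> \<open>The limit of a power over an exponential, taken at \<open>r\<^sup>2\<close>;
      it dominates because \<open>r \<le> r\<^sup>2\<close> for \<open>r \<ge> 1\<close>.\<close>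
    have "((\<lambda>r::real. (r\<^sup>2) ^ d / exp (r\<^sup>2)) \<longlongrightarrow> 0) at_top"
      by (rule filterlim_compose [OF tendsto_power_div_exp_0])
         (simp add: filterlim_pow_at_top filterlim_ident)
    then have "(?F \<longlongrightarrow> 0) at_top"
    proof (rule Lim_null_comparison [rotated])
      show "\<forall>\<^sub>F r::real in at_top. norm (?F r) \<le> (r\<^sup>2) ^ d / exp (r\<^sup>2)"
        using eventually_ge_at_top [of "1::real"]
      proof eventually_elim
        case (elim r)
        then have "r ^ d \<le> (r\<^sup>2) ^ d"
          by (intro power_mono) (auto simp: power2_eq_square)
        then show ?case using elim by (simp add: exp_minus divide_simps)
      qed
    qed
    then show "((?F \<circ> real_of_ereal) \<longlongrightarrow> 0) (at_left \<infinity>)"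
      by (simp add: ereal_tendsto_simps)
  qed auto
  moreover have "(\<integral>r. indicator {\<rho>..} r * radial_kernel d r \<partial>lborel) = (LBINT r:{\<rho><..}. radial_kernel d r)"
    unfolding set_lebesgue_integral_def
  proof (rule integral_cong_AE)
    show "AE r in lborel. indicator {\<rho>..} r * radial_kernel d r = indicator {\<rho><..} r *\<^sub>R radial_kernel d r"
      using AE_lborel_singleton [of \<rho>] by eventually_elim (auto simp: indicator_def)
  qed auto
  ultimately show ?thesis
    by (simp add: interval_integral_Ioi)
qed

text \<open>The ball lies in a cube, whose volume is a finite product of finite lengths.\<close>

lemma emeasure_L2_ball_finite:
  fixes n :: nat
  shows "emeasure (\<Pi>\<^sub>M i\<in>{..<n}. lborel) {x \<in> space (\<Pi>\<^sub>M i\<in>{..<n}. lborel). L2_set x {..<n} \<le> r} < \<infinity>"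
    (is "emeasure ?\<mu> ?B < _")
proof -
  interpret product_sigma_finite "\<lambda>_::nat. lborel :: real measure" ..
  have "?B \<subseteq> (\<Pi>\<^sub>E i\<in>{..<n}. {-r..r})"
  proof
    fix x assume x: "x \<in> ?B"
    have le: "\<bar>x i\<bar> \<le> r" if "i < n" for i
    proof -
      have "\<bar>x i\<bar> \<le> L2_set (\<lambda>i. \<bar>x i\<bar>) {..<n}"
        using that by (intro member_le_L2_set) auto
      also have "\<dots> = L2_set x {..<n}" by (simp add: L2_set_def)
      finally show ?thesis using x by simp
    qed
    have "\<forall>i\<in>{..<n}. x i \<in> {-r..r}"
    proof
      fix i assume "i \<in> {..<n}"
      then have "\<bar>x i\<bar> \<le> r" using le by simp
      then show "x i \<in> {-r..r}" unfolding atLeastAtMost_iff by linarith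
    qed
    moreover have "x \<in> extensional {..<n}"
      using x by (simp add: space_PiM PiE_def)
    ultimately show "x \<in> (\<Pi>\<^sub>E i\<in>{..<n}. {-r..r})"
      unfolding PiE_iff by blast
  qed
  then have "emeasure ?\<mu> ?B \<le> emeasure ?\<mu> (\<Pi>\<^sub>E i\<in>{..<n}. {-r..r})"
    by (intro emeasure_mono sets_PiM_I_finite) auto
  also have "\<dots> = (\<Prod>i<n. emeasure lborel {-r..r})"
    by (subst emeasure_PiM) auto
  also have "\<dots> < \<infinity>"
    unfolding infinity_ennreal_def less_top [symmetric]
    by (subst ennreal_prod_eq_top) (simp add: emeasure_lborel_Icc_eq)
  finally show ?thesis .
qed

lemma L2_set_dilation:
  assumes "c \<ge> 0"
  shows "L2_set (\<lambda>i\<in>I. c * x i) I = c * L2_set x I"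
proof -
  have "L2_set (\<lambda>i\<in>I. c * x i) I = L2_set (\<lambda>i. c * x i) I"
    by (rule L2_set_cong) auto
  also have "\<dots> = c * L2_set x I"
    using assms by (rule L2_set_right_distrib [symmetric])
  finally show ?thesis .
qed

lemma radial_projection_dilation:
  assumes "c > 0"
  shows "radial_projection n (\<lambda>i\<in>{..<n}. c * x i) = radial_projection n x"
  unfolding radial_projection_def L2_set_dilation [OF less_imp_le [OF assms]]
  by (rule restrict_ext) (use assms in simp)

text \<open>Makes the origin, where \<open>radial_projection\<close> divides by 0, negligible. In
  dimension 0 the product measure is a unit point mass there, hence \<open>n > 0\<close>.\<close>

lemma AE_L2_set_pos:
  fixes n :: nat
  assumes "n > 0"
  shows "AE x in (\<Pi>\<^sub>M i\<in>{..<n}. lborel). 0 < L2_set x {..<n}"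
proof (rule AE_I)
  interpret product_sigma_finite "\<lambda>_::nat. lborel :: real measure" ..
  have "x i = 0" if "\<not> 0 < L2_set x {..<n}" "i < n" for x :: "nat \<Rightarrow> real" and i :: nat
  proof -
    have "L2_set x {..<n} = 0" using that(1) L2_set_nonneg[of x "{..<n}"] by simp
    with that(2) show ?thesis by (simp add: L2_set_eq_0_iff)
  qed
  then show "{x \<in> space (\<Pi>\<^sub>M i\<in>{..<n}. lborel :: real measure). \<not> 0 < L2_set x {..<n}} \<subseteq> (\<Pi>\<^sub>E i\<in>{..<n}. {0})"
    unfolding space_PiM PiE_def Pi_def by auto
  show "emeasure (\<Pi>\<^sub>M i\<in>{..<n}. lborel :: real measure) (\<Pi>\<^sub>E i\<in>{..<n}. {0}) = 0"
    using assms by (subst emeasure_PiM) auto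
  show "(\<Pi>\<^sub>E i\<in>{..<n}. {0}) \<in> sets (\<Pi>\<^sub>M i\<in>{..<n}. lborel :: real measure)"
    by (intro sets_PiM_I_finite) auto
qed

lemma radial_projection_measurable_PiM [measurable]:
  "radial_projection n \<in> measurable (\<Pi>\<^sub>M i\<in>{..<n}. lborel) (\<Pi>\<^sub>M i\<in>{..<n}. lborel)"
  unfolding radial_projection_def by (rule measurable_restrict) measurable

text \<open>
  With \<open>f x = \<bar>x\<bar>\<^sup>d g x\<close> and \<open>g\<close> constant along rays, the factor \<open>\<bar>x\<bar>\<^sup>d exp (- \<bar>x\<bar>\<^sup>2)\<close> is the integral of the
  radial kernel over all \<open>r \<ge> \<bar>x\<bar>\<close>. By Fubini it remains to integrate \<open>g\<close> over balls of radius \<open>r\<close>,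
  which by dilation gives \<open>r\<^sup>n\<close> times the integral over the unit ball.
\<close>

lemma integral_gaussian_eq_sphere_integral:
  fixes f :: "(nat \<Rightarrow> real) \<Rightarrow> real"
  assumes n: "n > 0"
    and f [measurable]: "f \<in> borel_measurable (\<Pi>\<^sub>M i\<in>{..<n}. lborel)"
    and hom: "\<And>c x. c > 0 \<Longrightarrow> f (\<lambda>i\<in>{..<n}. c * x i) = c ^ d * f x"
    and bound: "\<And>x. x \<in> unit_sphere n \<Longrightarrow> \<bar>f x\<bar> \<le> B"
  shows "(\<integral>x. f x * exp (- (L2_set x {..<n})\<^sup>2) \<partial>(\<Pi>\<^sub>M i\<in>{..<n}. lborel)) =
       Gamma (real (n + d) / 2) / 2 * (\<integral>x. f x \<partial>sphere_area n)"
proof -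
  let ?\<mu> = "\<Pi>\<^sub>M i\<in>{..<n}. lborel :: real measure"
  let ?N = "\<lambda>x::nat \<Rightarrow> real. L2_set x {..<n}"
  interpret P: product_sigma_finite "\<lambda>_::nat. lborel :: real measure" ..
  interpret S: sigma_finite_measure ?\<mu> by (rule P.sigma_finite) simp
  interpret pair_sigma_finite lborel ?\<mu> ..
  define g where "g x = f (radial_projection n x)" for x
  \<comment> \<open>The indicator of the punctured ball of radius \<open>r\<close>, kept as a
    function of both variables because Fubini needs joint measurability.\<close>
  define b where "b r x = (if 0 < ?N x \<and> ?N x \<le> r then 1 else 0 :: real)" for r x
  have g [measurable]: "g \<in> borel_measurable ?\<mu>" unfolding g_def by measurable
  have b [measurable]: "(\<lambda>(r, x). b r x) \<in> borel_measurable (lborel \<Otimes>\<^sub>M ?\<mu>)"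
    unfolding b_def by measurable
  have br [measurable]: "b r \<in> borel_measurable ?\<mu>" for r
    unfolding b_def by measurable
  have b1: "b 1 x = indicator (punctured_ball n) x" if "x \<in> space ?\<mu>" for x
    using that by (auto simp: b_def punctured_ball_def space_PiM)
  have f_eq: "f x = ?N x ^ d * g x" if "x \<in> space ?\<mu>" "0 < ?N x" for x
  proof -
    have "x = (\<lambda>i\<in>{..<n}. ?N x * radial_projection n x i)"
      using that by (auto simp: radial_projection_def fun_eq_iff space_PiM PiE_def extensional_def)
    with hom[OF that(2), of "radial_projection n x"] show ?thesis by (simp add: g_def)
  qed
  \<comment> \<open>The extra \<open>h\<close> lets one scaling identity serve twice:
    \<open>abs\<close> for the integrability in Fubini, the identity for the value.\<close>
  have dil: "(\<integral>x. h (g x) * b r x \<partial>?\<mu>) = r ^ n * (\<integral>x. h (g x) * b 1 x \<partial>?\<mu>)"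
    if "r > 0" and [measurable]: "h \<in> borel_measurable borel" for r and h :: "real \<Rightarrow> real"
  proof -
    have "(\<integral>x. h (g x) * b r x \<partial>?\<mu>) =
        r ^ n * (\<integral>x. h (g (\<lambda>i\<in>{..<n}. r * x i)) * b r (\<lambda>i\<in>{..<n}. r * x i) \<partial>?\<mu>)"
      by (rule integral_PiM_lborel_dilation [OF that(1)]) measurable
    also have "(\<lambda>x. h (g (\<lambda>i\<in>{..<n}. r * x i)) * b r (\<lambda>i\<in>{..<n}. r * x i)) = (\<lambda>x. h (g x) * b 1 x)"
      using that(1) unfolding g_def b_def radial_projection_dilation [OF that(1)] L2_set_dilation [OF less_imp_le [OF that(1)]]
      by (simp add: zero_less_mult_iff)
    finally show ?thesis .
  qed
  have gb: "integrable ?\<mu> (\<lambda>x. g x * b r x)" for r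
  proof (rule Bochner_Integration.integrable_bound)
    let ?C = "{x \<in> space ?\<mu>. ?N x \<le> r}"
    have "?C \<in> sets ?\<mu>" by measurable
    then show "integrable ?\<mu> (\<lambda>x. B * indicator ?C x)"
      using emeasure_L2_ball_finite [of n r] by (intro integrable_mult_right integrable_real_indicator) simp_all
    have "\<bar>g x\<bar> \<le> B" if "x \<in> space ?\<mu>" "0 < ?N x" for x
    proof -
      have "radial_projection n x = (\<lambda>i\<in>{..<n}. inverse (?N x) * x i)"
        by (simp add: radial_projection_def divide_inverse mult.commute)
      then have "L2_set (radial_projection n x) {..<n} = 1"
        using that(2) by (simp add: L2_set_dilation)
      then have "radial_projection n x \<in> unit_sphere n"
        by (simp add: unit_sphere_def radial_projection_def)
      then show ?thesis unfolding g_def by (rule bound)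
    qed
    then show "AE x in ?\<mu>. norm (g x * b r x) \<le> norm (B * indicator ?C x)"
      by (intro AE_I2) (force simp: b_def abs_mult)
  qed measurable
  define G where "G = (\<integral>x. g x * b 1 x \<partial>?\<mu>)"
  \<comment> \<open>Restricted to the radii at which \<open>dil\<close> applies; the omitted
    endpoint 0 is a null set.\<close>
  define k where "k r = indicator {0<..} r * radial_kernel d r" for r
  have [measurable]: "k \<in> borel_measurable borel" unfolding k_def by measurable
  have k_int: "has_bochner_integral lborel (\<lambda>r. r ^ n * k r) (real n / 2 * Gamma (real (n + d) / 2))"
  proof (rule has_bochner_integral_cong_AE [THEN iffD1, OF _ _ _ radial_kernel_moment])
    show "AE r in lborel. indicator {0..} r *\<^sub>R (r ^ n * radial_kernel d r) = r ^ n * k r"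
      using AE_lborel_singleton [of 0] by eventually_elim (auto simp: k_def indicator_def)
  qed (use n in auto)
  have int: "integrable (lborel \<Otimes>\<^sub>M ?\<mu>) (\<lambda>(r, x). g x * b r x * k r)"
  proof (rule Fubini_integrable)
    have "(\<integral>x. norm (g x * b r x * k r) \<partial>?\<mu>) = (r ^ n * \<bar>k r\<bar>) * (\<integral>x. \<bar>g x\<bar> * b 1 x \<partial>?\<mu>)" for r
    proof (cases "r > 0")
      case True
      have "(\<integral>x. norm (g x * b r x * k r) \<partial>?\<mu>) = (\<integral>x. \<bar>g x\<bar> * b r x \<partial>?\<mu>) * \<bar>k r\<bar>"
        unfolding integral_mult_left_zero [symmetric]
        by (rule Bochner_Integration.integral_cong) (auto simp: abs_mult b_def)
      then show ?thesis using dil[OF True, of abs] by simp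
    qed (simp add: k_def)
    moreover have "integrable lborel (\<lambda>r. r ^ n * \<bar>k r\<bar>)"
    proof -
      have "(\<lambda>r. \<bar>r ^ n * k r\<bar>) = (\<lambda>r. r ^ n * \<bar>k r\<bar>)"
        by (auto simp: k_def abs_mult fun_eq_iff indicator_def)
      with integrable_abs[OF has_bochner_integral_iff[THEN iffD1, THEN conjunct1, OF k_int]]
      show ?thesis by simp
    qed
    ultimately show "integrable lborel (\<lambda>r. \<integral>x. norm (case (r, x) of (r, x) \<Rightarrow> g x * b r x * k r) \<partial>?\<mu>)"
      by simp
    show "AE r in lborel. integrable ?\<mu> (\<lambda>x. case (r, x) of (r, x) \<Rightarrow> g x * b r x * k r)"
      using gb by simp
  qed measurable
  have "(\<integral>x. f x * exp (- (?N x)\<^sup>2) \<partial>?\<mu>) = (\<integral>x. (\<integral>r. g x * b r x * k r \<partial>lborel) \<partial>?\<mu>)"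
  proof (rule integral_cong_AE)
    show "AE x in ?\<mu>. f x * exp (- (?N x)\<^sup>2) = (\<integral>r. g x * b r x * k r \<partial>lborel)"
      using AE_L2_set_pos [OF n] AE_space
    proof eventually_elim
      case (elim x)
      have "(\<lambda>r. g x * b r x * k r) = (\<lambda>r. g x * (indicator {?N x..} r * radial_kernel d r))"
        using elim by (auto simp: b_def k_def indicator_def)
      then have "(\<integral>r. g x * b r x * k r \<partial>lborel) = g x * (?N x ^ d * exp (- (?N x)\<^sup>2))"
        using radial_kernel_tail [OF elim(1), of d] by simp
      then show ?case using f_eq elim by simp
    qed
  qed measurable
  also have "\<dots> = (\<integral>r. (\<integral>x. g x * b r x * k r \<partial>?\<mu>) \<partial>lborel)"
    by (rule Fubini_integral [OF int])
  also have "\<dots> = (\<integral>r. r ^ n * k r * G \<partial>lborel)"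
  proof (rule Bochner_Integration.integral_cong [OF refl])
    fix r show "(\<integral>x. g x * b r x * k r \<partial>?\<mu>) = r ^ n * k r * G"
      using dil[of r "\<lambda>x. x"] by (cases "r > 0") (simp_all add: k_def G_def)
  qed
  also have "\<dots> = real n / 2 * Gamma (real (n + d) / 2) * G"
    using k_int by (simp add: has_bochner_integral_iff)
  also have "G = (\<integral>x. indicator (punctured_ball n) x * f (radial_projection n x) \<partial>?\<mu>)"
    unfolding G_def by (rule Bochner_Integration.integral_cong) (auto simp: b1 g_def)
  also have "real n / 2 * Gamma (real (n + d) / 2) * \<dots> = Gamma (real (n + d) / 2) / 2 * (\<integral>x. f x \<partial>sphere_area n)"
    by (subst sphere_integral_eq) simp_all
  finally show ?thesis .
qed

section \<open>Moments of the sphere\<close>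

lemma finite_measure_sphere_area: "finite_measure (sphere_area n)"
proof
  let ?\<mu> = "\<Pi>\<^sub>M i\<in>{..<n}. lborel :: real measure"
  have "emeasure (sphere_area n) (space (sphere_area n)) \<le>
      of_nat n * emeasure ?\<mu> {x \<in> space ?\<mu>. L2_set x {..<n} \<le> 1}"
    unfolding emeasure_sphere_area [OF sets.top]
    by (intro mult_left_mono emeasure_mono) (auto simp: punctured_ball_def space_PiM)
  also have "\<dots> < \<infinity>"
    using emeasure_L2_ball_finite [of n 1]
    by (simp add: ennreal_mult_less_top ennreal_of_nat_eq_real_of_nat)
  finally show "emeasure (sphere_area n) (space (sphere_area n)) \<noteq> \<infinity>" by simp
qed

lemma abs_le_1_unit_sphere:
  assumes "x \<in> unit_sphere n" "i < n"
  shows "\<bar>x i\<bar> \<le> 1"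
proof -
  have "\<bar>x i\<bar> \<le> L2_set (\<lambda>i. \<bar>x i\<bar>) {..<n}"
    using assms by (intro member_le_L2_set) auto
  also have "\<dots> = 1"
    using assms(1) by (simp add: unit_sphere_def L2_set_def)
  finally show ?thesis .
qed

lemma abs_monomial_le_1_unit_sphere:
  assumes "x \<in> unit_sphere n"
  shows "\<bar>\<Prod>i<n. x i ^ a i\<bar> \<le> 1"
  unfolding abs_prod power_abs
  by (intro prod_le_1 conjI power_le_one) (auto simp: abs_le_1_unit_sphere [OF assms])

definition sphere_moment :: "nat \<Rightarrow> (nat \<Rightarrow> nat) \<Rightarrow> real" where
  "sphere_moment n a = 2 * (\<Prod>i<n. gaussian_moment (a i)) / Gamma (real (n + (\<Sum>i<n. a i)) / 2)"

lemma integrable_sphere_monomial: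
  "integrable (sphere_area n) (\<lambda>x. \<Prod>i<n. x i ^ a i)"
proof -
  interpret finite_measure "sphere_area n" by (rule finite_measure_sphere_area)
  show ?thesis
  proof (rule integrable_const_bound)
    show "AE x in sphere_area n. norm (\<Prod>i<n. x i ^ a i) \<le> 1"
      using abs_monomial_le_1_unit_sphere by (intro AE_I2) (simp add: space_sphere_area)
    have "(\<lambda>x. \<Prod>i<n. x i ^ a i) \<in> borel_measurable (restrict_space (\<Pi>\<^sub>M i\<in>{..<n}. borel) (unit_sphere n))"
      by (rule measurable_restrict_space1) measurable
    then show "(\<lambda>x. \<Prod>i<n. x i ^ a i) \<in> borel_measurable (sphere_area n)"
      by (simp add: sphere_area_def)
  qed
qed

lemma integral_sphere_monomial:
  assumes n: "n > 0"
  shows "(\<integral>x. (\<Prod>i<n. x i ^ a i) \<partial>sphere_area n) = sphere_moment n a"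
proof -
  let ?\<mu> = "\<Pi>\<^sub>M i\<in>{..<n}. lborel :: real measure"
  let ?d = "\<Sum>i<n. a i"
  interpret product_sigma_finite "\<lambda>_::nat. lborel :: real measure" ..
  have "(\<integral>x. (\<Prod>i<n. x i ^ a i) * exp (- (L2_set x {..<n})\<^sup>2) \<partial>?\<mu>) =
      Gamma (real (n + ?d) / 2) / 2 * (\<integral>x. (\<Prod>i<n. x i ^ a i) \<partial>sphere_area n)"
  proof (rule integral_gaussian_eq_sphere_integral [OF n, where B = 1])
    show "(\<Prod>i<n. (\<lambda>i\<in>{..<n}. c * x i) i ^ a i) = c ^ ?d * (\<Prod>i<n. x i ^ a i)" for c :: real and x
      by (simp add: power_mult_distrib prod.distrib power_sum)
  qed (auto intro: abs_monomial_le_1_unit_sphere)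
  moreover have "(\<integral>x. (\<Prod>i<n. x i ^ a i) * exp (- (L2_set x {..<n})\<^sup>2) \<partial>?\<mu>) =
      (\<integral>x. (\<Prod>i<n. exp (- (x i)\<^sup>2) * x i ^ a i) \<partial>?\<mu>)"
  proof (rule Bochner_Integration.integral_cong [OF refl])
    fix x :: "nat \<Rightarrow> real"
    have "(L2_set x {..<n})\<^sup>2 = (\<Sum>i<n. (x i)\<^sup>2)"
      by (simp add: L2_set_def sum_nonneg)
    then show "(\<Prod>i<n. x i ^ a i) * exp (- (L2_set x {..<n})\<^sup>2) = (\<Prod>i<n. exp (- (x i)\<^sup>2) * x i ^ a i)"
      by (simp add: prod.distrib exp_sum sum_negf [symmetric] mult.commute)
  qed
  moreover have "\<dots> = (\<Prod>i<n. gaussian_moment (a i))"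
    using gaussian_moment_line
    by (subst product_integral_prod) (auto simp: has_bochner_integral_iff)
  moreover have "Gamma (real (n + ?d) / 2) > 0"
    using n by (intro Gamma_real_pos half_gt_zero of_nat_0_less_iff [THEN iffD2]) simp
  ultimately show ?thesis
    by (simp add: sphere_moment_def field_simps)
qed

subsection \<open>Gauss-Jacobi quadrature\<close>

text \<open>Substitute \<open>t = (1 + s) / 2\<close> in the Beta integral over
  \<open>{0..1}\<close>; the factor 2 is the Jacobian. The bases \<open>(1 - s) / 2\<close> and
  \<open>(1 + s) / 2\<close> are, up to sign, those in which \<open>jacobi_poly\<close> is expanded,
  so each of its terms integrates to one Beta value.\<close>

lemma has_bochner_integral_Beta:
  fixes a b :: real
  assumes "a > -1" "b > -1"
  shows "has_bochner_integral lborel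
    (\<lambda>s. indicator {-1..1} s *\<^sub>R (((1 - s) / 2) powr a * ((1 + s) / 2) powr b)) (2 * Beta (b + 1) (a + 1))"
proof -
  let ?f = "\<lambda>t. indicator {0..1} t *\<^sub>R (t powr b * (1 - t) powr a) :: real"
  have "((\<lambda>t. t powr b * (1 - t) powr a) has_integral Beta (b + 1) (a + 1)) {0..1}"
    using has_integral_Beta_real [of "b + 1" "a + 1"] assms by simp
  then have I: "(?f has_integral Beta (b + 1) (a + 1)) UNIV"
    by (subst (asm) has_integral_restrict_UNIV [symmetric])
       (auto elim!: has_integral_eq [rotated] simp: indicator_def)
  \<comment> \<open>Nonnegativity permits the passage from the gauge integral to the Lebesgue
    integral.\<close>
  have nonneg: "?f t \<ge> 0" for t by (simp add: indicator_def)
  have "has_bochner_integral lborel ?f (Beta (b + 1) (a + 1))"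
  proof (rule has_bochner_integral_nn_integral)
    show "integral\<^sup>N lborel ?f = Beta (b + 1) (a + 1)"
      by (rule nn_integral_has_integral_lborel [OF _ nonneg I]) measurable
    show "0 \<le> Beta (b + 1) (a + 1)"
      using I nonneg by (rule has_integral_nonneg)
  qed (use nonneg in auto)
  then have "has_bochner_integral lborel (\<lambda>s. ?f (1 / 2 + (1 / 2) * s)) (Beta (b + 1) (a + 1) /\<^sub>R \<bar>1 / 2\<bar>)"
    by (subst (asm) lborel_has_bochner_integral_real_affine_iff [of "1/2" _ _ "1/2"]) simp_all
  also have "(\<lambda>s. ?f (1 / 2 + (1 / 2) * s)) =
      (\<lambda>s. indicator {-1..1} s *\<^sub>R (((1 - s) / 2) powr a * ((1 + s) / 2) powr b))"
    by (auto simp: fun_eq_iff indicator_def field_simps)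
  finally show ?thesis by simp
qed

lemma powr_one_minus_square:
  fixes s :: real
  assumes "s \<in> {-1..1}"
  shows "(1 - s\<^sup>2) powr \<beta> = 4 powr \<beta> * (((1 - s) / 2) powr \<beta> * ((1 + s) / 2) powr \<beta>)"
proof -
  have "(1 - s\<^sup>2) = 4 * (((1 - s) / 2) * ((1 + s) / 2))"
    by (simp add: field_simps power2_eq_square)
  then show ?thesis
    using assms by (simp only: powr_mult [of 4] powr_mult [of "(1 - s) / 2"])
qed

lemma set_integrable_jacobi_weight:
  fixes \<beta> :: real
  assumes "\<beta> > -1"
  shows "set_integrable lborel {-1..1} (\<lambda>s. (1 - s\<^sup>2) powr \<beta>)"
proof -
  have "set_integrable lborel {-1..1} (\<lambda>s. 4 powr \<beta> * (((1 - s) / 2) powr \<beta> * ((1 + s) / 2) powr \<beta>))"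
    using has_bochner_integral_Beta [OF assms assms]
    by (intro set_integrable_mult_right) (simp add: set_integrable_def has_bochner_integral_iff)
  then show ?thesis
    by (rule set_integrable_cong [THEN iffD1, rotated -1]) (simp_all add: powr_one_minus_square)
qed

lemma set_integrable_jacobi:
  fixes \<beta> :: real and p :: "real poly"
  assumes "\<beta> > -1"
  shows "set_integrable lborel {-1..1} (\<lambda>s. poly p s * (1 - s\<^sup>2) powr \<beta>)"
proof -
  have "compact (poly p ` {-1..1})"
    by (intro compact_continuous_image continuous_intros) auto
  then obtain B where B: "\<And>s. s \<in> {-1..1} \<Longrightarrow> \<bar>poly p s\<bar> \<le> B"
    by (force dest!: compact_imp_bounded simp: bounded_iff)
  have "set_integrable lborel {-1..1} (\<lambda>s. B * (1 - s\<^sup>2) powr \<beta>)"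
    by (intro set_integrable_mult_right set_integrable_jacobi_weight assms)
  then show ?thesis
    unfolding set_integrable_def
  proof (rule Bochner_Integration.integrable_bound)
    show "AE s in lborel. norm (indicat_real {-1..1} s *\<^sub>R (poly p s * (1 - s\<^sup>2) powr \<beta>))
        \<le> norm (indicat_real {-1..1} s *\<^sub>R (B * (1 - s\<^sup>2) powr \<beta>))"
      using B by (intro AE_I2) (force simp: indicator_def abs_mult intro!: mult_right_mono order_trans [OF B])
    have [measurable]: "poly p \<in> borel_measurable borel"
      by (intro borel_measurable_continuous_onI continuous_intros)
    show "(\<lambda>s. indicat_real {-1..1} s *\<^sub>R (poly p s * (1 - s\<^sup>2) powr \<beta>)) \<in> borel_measurable lborel"
      by measurable
  qed
qed

section \<open>Orthogonality of the Jacobi polynomials\<close>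

text \<open>Pascal's rule. In terms of finite differences, one difference is absorbed into the
  function, which drives the induction on the order below.\<close>

lemma alternating_binomial_sum_Suc:
  fixes f :: "nat \<Rightarrow> real"
  shows "(\<Sum>k\<le>Suc N. (-1) ^ k * real (Suc N choose k) * f k) =
         (\<Sum>k\<le>N. (-1) ^ k * real (N choose k) * (f k - f (Suc k)))"
proof -
  have "(\<Sum>k\<le>Suc N. (-1) ^ k * real (Suc N choose k) * f k) =
      f 0 + (\<Sum>k\<le>N. (-1) ^ Suc k * real (Suc N choose Suc k) * f (Suc k))"
    by (simp only: sum.atMost_Suc_shift) simp
  also have "(\<Sum>k\<le>N. (-1) ^ Suc k * real (Suc N choose Suc k) * f (Suc k)) =
      - (\<Sum>k\<le>N. (-1) ^ k * real (N choose k) * f (Suc k)) +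
        (\<Sum>k\<le>N. (-1) ^ Suc k * real (N choose Suc k) * f (Suc k))"
    by (simp add: sum.distrib [symmetric] sum_negf [symmetric] algebra_simps)
  also have "f 0 + (- (\<Sum>k\<le>N. (-1) ^ k * real (N choose k) * f (Suc k)) +
        (\<Sum>k\<le>N. (-1) ^ Suc k * real (N choose Suc k) * f (Suc k))) =
     (\<Sum>k\<le>Suc N. (-1) ^ k * real (N choose k) * f k) - (\<Sum>k\<le>N. (-1) ^ k * real (N choose k) * f (Suc k))"
    by (simp only: sum.atMost_Suc_shift [of _ N]) simp
  also have "\<dots> = (\<Sum>k\<le>N. (-1) ^ k * real (N choose k) * (f k - f (Suc k)))"
    by (simp add: right_diff_distrib sum_subtractf)
  finally show ?thesis .
qed

text \<open>Rising factorials behave under differences as powers do under derivatives: the degree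
  drops by one.\<close>

lemma pochhammer_diff:
  fixes y :: real
  shows "pochhammer y (Suc j) - pochhammer (y - 1) (Suc j) = real (Suc j) * pochhammer y j"
proof -
  have "pochhammer (y - 1) (Suc j) = (y - 1) * pochhammer y j"
    by (simp add: pochhammer_rec)
  then show ?thesis by (simp add: pochhammer_rec' algebra_simps)
qed

text \<open>An \<open>N\<close>-th difference annihilates polynomials of degree below
  \<open>N\<close>; as a function of \<open>k\<close> the rising factorial is one of degree
  \<open>j\<close>.\<close>

lemma alternating_binomial_pochhammer_sum:
  fixes y :: real
  assumes "j < N"
  shows "(\<Sum>k\<le>N. (-1) ^ k * real (N choose k) * pochhammer (y - real k) j) = 0"
  using assms
proof (induction N arbitrary: j)
  case (Suc N)
  show ?case
  proof (cases j)
    case 0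
    then show ?thesis
      using alternating_binomial_sum_Suc [of N "\<lambda>_. 1"] by simp
  next
    case (Suc i)
    have "(\<Sum>k\<le>Suc N. (-1) ^ k * real (Suc N choose k) * pochhammer (y - real k) j) =
       (\<Sum>k\<le>N. (-1) ^ k * real (N choose k) * (real (Suc i) * pochhammer (y - real k) i))"
      unfolding alternating_binomial_sum_Suc Suc pochhammer_diff [symmetric]
      by (simp add: algebra_simps)
    also have "\<dots> = real (Suc i) * (\<Sum>k\<le>N. (-1) ^ k * real (N choose k) * pochhammer (y - real k) i)"
      by (simp add: sum_distrib_left mult_ac)
    also have "\<dots> = 0" using Suc.IH [of i] Suc.prems Suc by simp
    finally show ?thesis .
  qed
qed simp

text \<open>Turning \<open>(s - 1) / 2\<close> into \<open>(1 - s) / 2\<close> makes both bases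
  nonnegative on \<open>{-1..1}\<close>, as in the Beta integrands, and produces the alternating
  sign of a finite difference.\<close>

lemma poly_jacobi_poly:
  "poly (jacobi_poly N \<alpha> \<beta>) s = (\<Sum>k\<le>N. ((real N + \<alpha>) gchoose (N - k)) * ((real N + \<beta>) gchoose k) *
     ((-1) ^ k * (((1 - s) / 2) ^ k * ((1 + s) / 2) ^ (N - k))))"
proof -
  have "poly [:- 1 / 2, 1 / 2:] s = - ((1 - s) / 2)" "poly [:1 / 2, 1 / 2:] s = (1 + s) / 2"
    by (simp_all add: field_simps)
  then show ?thesis
    unfolding jacobi_poly_def poly_sum poly_smult poly_mult poly_power
    by (intro sum.cong refl) (simp only: power_minus [of "(1 - s) / 2"] mult_ac)
qed

lemma degree_jacobi_poly_le: "degree (jacobi_poly N \<alpha> \<beta>) \<le> N"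
  unfolding jacobi_poly_def
proof (rule degree_sum_le)
  fix k assume "k \<in> {..N}"
  have "degree ([:- 1 / 2, 1 / 2:] ^ k * [:1 / 2, 1 / 2 :: real:] ^ (N - k)) \<le>
      degree [:- 1 / 2, 1 / 2 :: real:] * k + degree [:1 / 2, 1 / 2 :: real:] * (N - k)"
    by (intro order_trans [OF degree_mult_le] add_mono degree_power_le)
  also have "\<dots> \<le> N" using \<open>k \<in> {..N}\<close> by simp
  finally show "degree (smult (((real N + \<alpha>) gchoose (N - k)) * ((real N + \<beta>) gchoose k))
      ([:- 1 / 2, 1 / 2:] ^ k * [:1 / 2, 1 / 2:] ^ (N - k))) \<le> N"
    by (rule order_trans [OF degree_smult_le])
qed simp

lemma gbinomial_Gamma_real:
  fixes z :: real
  assumes "z > -1"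
  shows "(z gchoose n) = Gamma (z + 1) / (fact n * Gamma (z - real n + 1))"
  using assms by (intro gbinomial_Gamma) (auto dest: nonpos_Ints_nonpos)

text \<open>At \<open>s = 1\<close> only the term \<open>k = 0\<close> survives, and its binomial
  coefficient is positive.\<close>

lemma jacobi_poly_nonzero:
  assumes "\<alpha> > -1"
  shows "jacobi_poly N \<alpha> \<beta> \<noteq> 0"
proof -
  have "poly (jacobi_poly N \<alpha> \<beta>) 1 = ((real N + \<alpha>) gchoose N)"
    unfolding poly_jacobi_poly by (subst sum.remove [of _ 0]) (auto intro!: sum.neutral)
  also have "\<dots> = Gamma (real N + \<alpha> + 1) / (fact N * Gamma (\<alpha> + 1))"
    using assms by (subst gbinomial_Gamma_real) auto
  also have "\<dots> > 0"
    using assms by (intro divide_pos_pos mult_pos_pos Gamma_real_pos) auto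
  finally show ?thesis by auto
qed

lemma jacobi_integral_monomial:
  fixes \<beta> :: real
  assumes "\<beta> > -1"
  shows "has_bochner_integral lborel
    (\<lambda>s. indicator {-1..1} s *\<^sub>R (((1 - s) / 2) ^ i * ((1 + s) / 2) ^ j * (1 - s\<^sup>2) powr \<beta>))
    (2 * 4 powr \<beta> * Beta (\<beta> + real j + 1) (\<beta> + real i + 1))"
proof -
  have "has_bochner_integral lborel
    (\<lambda>s. 4 powr \<beta> * (indicator {-1..1} s *\<^sub>R (((1 - s) / 2) powr (\<beta> + real i) * ((1 + s) / 2) powr (\<beta> + real j))))
    (4 powr \<beta> * (2 * Beta (\<beta> + real j + 1) (\<beta> + real i + 1)))"
    using assms by (intro has_bochner_integral_mult_right has_bochner_integral_Beta) auto
  then have *: "has_bochner_integral lborel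
    (\<lambda>s. 4 powr \<beta> * (indicator {-1..1} s *\<^sub>R (((1 - s) / 2) powr (\<beta> + real i) * ((1 + s) / 2) powr (\<beta> + real j))))
    (2 * 4 powr \<beta> * Beta (\<beta> + real j + 1) (\<beta> + real i + 1))"
    by (simp only: mult_ac)
  show ?thesis
  proof (rule has_bochner_integral_cong_AE [THEN iffD1, OF _ _ _ *])
    \<comment> \<open>Discarding the endpoints makes both bases positive, as the conversion between
      \<open>powr\<close> and integer powers requires.\<close>
    show "AE s in lborel. 4 powr \<beta> * (indicator {-1..1} s *\<^sub>R
        (((1 - s) / 2) powr (\<beta> + real i) * ((1 + s) / 2) powr (\<beta> + real j))) =
      indicator {-1..1} s *\<^sub>R (((1 - s) / 2) ^ i * ((1 + s) / 2) ^ j * (1 - s\<^sup>2) powr \<beta>)"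
      using AE_lborel_singleton [of 1] AE_lborel_singleton [of "-1"]
    proof eventually_elim
      case (elim s)
      then show ?case
        by (cases "s \<in> {-1..1}")
           (auto simp: powr_one_minus_square powr_add powr_realpow)
    qed
  qed auto
qed

text \<open>
  Termwise Beta integrals turn the left-hand side into a multiple of the \<open>N\<close>-th finite difference
  of a polynomial of degree \<open>j < N\<close>.
\<close>

lemma jacobi_orthogonal_monomial:
  fixes \<beta> :: real
  assumes \<beta>: "\<beta> > -1" and j: "j < N"
  shows "(LBINT s:{-1..1}. poly (jacobi_poly N \<beta> \<beta>) s * ((1 + s) / 2) ^ j * (1 - s\<^sup>2) powr \<beta>) = 0"
proof -
  let ?c = "\<lambda>k. ((real N + \<beta>) gchoose (N - k)) * ((real N + \<beta>) gchoose k) * (-1) ^ k"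
  let ?C = "2 * 4 powr \<beta> * (Gamma (real N + \<beta> + 1))\<^sup>2 / (fact N * Gamma (2 * \<beta> + real N + real j + 2))"
  have "has_bochner_integral lborel
    (\<lambda>s. \<Sum>k\<le>N. ?c k * (indicator {-1..1} s *\<^sub>R (((1 - s) / 2) ^ k * ((1 + s) / 2) ^ (N - k + j) * (1 - s\<^sup>2) powr \<beta>)))
    (\<Sum>k\<le>N. ?c k * (2 * 4 powr \<beta> * Beta (\<beta> + real (N - k + j) + 1) (\<beta> + real k + 1)))"
    by (intro has_bochner_integral_sum has_bochner_integral_mult_right jacobi_integral_monomial \<beta>)
  also have "(\<lambda>s. \<Sum>k\<le>N. ?c k * (indicator {-1..1} s *\<^sub>R (((1 - s) / 2) ^ k * ((1 + s) / 2) ^ (N - k + j) * (1 - s\<^sup>2) powr \<beta>))) =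
    (\<lambda>s. indicator {-1..1} s *\<^sub>R (poly (jacobi_poly N \<beta> \<beta>) s * ((1 + s) / 2) ^ j * (1 - s\<^sup>2) powr \<beta>))"
    unfolding poly_jacobi_poly power_add real_scaleR_def sum_distrib_left sum_distrib_right
    by (simp only: mult_ac)
  finally have "(LBINT s:{-1..1}. poly (jacobi_poly N \<beta> \<beta>) s * ((1 + s) / 2) ^ j * (1 - s\<^sup>2) powr \<beta>) =
    (\<Sum>k\<le>N. ?c k * (2 * 4 powr \<beta> * Beta (\<beta> + real (N - k + j) + 1) (\<beta> + real k + 1)))"
    by (simp add: has_bochner_integral_iff set_lebesgue_integral_def)
  also have "\<dots> = (\<Sum>k\<le>N. ?C * ((-1) ^ k * real (N choose k) * pochhammer (\<beta> + real N + 1 - real k) j))"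
  proof (intro sum.cong refl)
    fix k assume "k \<in> {..N}"
    then have k: "k \<le> N" by simp
    define G where "G x = Gamma (x :: real)" for x
    have pos: "G (\<beta> + real k + 1) > 0" "G (\<beta> + real N + 1 - real k) > 0" "G (2 * \<beta> + real N + real j + 2) > 0"
      using \<beta> k by (auto simp: G_def intro!: Gamma_real_pos)
    \<comment> \<open>The Gamma value at \<open>\<beta> + real k + 1\<close> in \<open>1\<close>
      cancels against the Beta value in \<open>3\<close>. The other two values depending on
      \<open>k\<close> form the rising factorial in \<open>4\<close>, the factorials form the
      binomial in \<open>5\<close>, and \<open>?C\<close> collects the rest.\<close>
    have 1: "(real N + \<beta>) gchoose (N - k) = G (real N + \<beta> + 1) / (fact (N - k) * G (\<beta> + real k + 1))"
      using \<beta> k by (subst gbinomial_Gamma_real) (auto simp: G_def of_nat_diff add_ac)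
    have 2: "(real N + \<beta>) gchoose k = G (real N + \<beta> + 1) / (fact k * G (\<beta> + real N + 1 - real k))"
      using \<beta> k by (subst gbinomial_Gamma_real) (auto simp: G_def algebra_simps)
    have 3: "Beta (\<beta> + real (N - k + j) + 1) (\<beta> + real k + 1) =
        G (\<beta> + real N + 1 - real k + real j) * G (\<beta> + real k + 1) / G (2 * \<beta> + real N + real j + 2)"
      using k by (simp add: Beta_def G_def of_nat_diff algebra_simps)
    have 4: "pochhammer (\<beta> + real N + 1 - real k) j =
        G (\<beta> + real N + 1 - real k + real j) / G (\<beta> + real N + 1 - real k)"
      using \<beta> k by (subst pochhammer_Gamma) (auto simp: G_def dest: nonpos_Ints_nonpos)
    have 5: "real (N choose k) = fact N / (fact k * fact (N - k))"
      using k by (rule binomial_fact)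
    show "?c k * (2 * 4 powr \<beta> * Beta (\<beta> + real (N - k + j) + 1) (\<beta> + real k + 1)) =
        ?C * ((-1) ^ k * real (N choose k) * pochhammer (\<beta> + real N + 1 - real k) j)"
      unfolding 1 2 3 4 5 G_def [symmetric] using pos by (simp add: power2_eq_square divide_simps)
  qed
  also have "\<dots> = ?C * (\<Sum>k\<le>N. (-1) ^ k * real (N choose k) * pochhammer (\<beta> + real N + 1 - real k) j)"
    by (simp add: sum_distrib_left)
  also have "\<dots> = 0"
    by (simp add: alternating_binomial_pochhammer_sum j)
  finally show ?thesis .
qed

lemma jacobi_orthogonal:
  fixes \<beta> :: real
  assumes \<beta>: "\<beta> > -1" and q: "degree q < N"
  shows "(LBINT s:{-1..1}. poly (jacobi_poly N \<beta> \<beta> * q) s * (1 - s\<^sup>2) powr \<beta>) = 0"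
proof -
  let ?P = "jacobi_poly N \<beta> \<beta>"
  \<comment> \<open>The coefficients of \<open>r\<close> are those of \<open>q\<close> in powers of
    \<open>(1 + s) / 2\<close>, the test functions of
    \<open>jacobi_orthogonal_monomial\<close>.\<close>
  define r where "r = pcompose q [:-1, 2:]"
  have r: "degree r = degree q"
    by (simp add: r_def degree_pcompose)
  have q_eq: "poly q s = (\<Sum>j\<le>degree q. coeff r j * ((1 + s) / 2) ^ j)" for s
  proof -
    have "poly q s = poly r ((1 + s) / 2)"
      by (simp add: r_def poly_pcompose field_simps)
    then show ?thesis by (simp add: poly_altdef r)
  qed
  have "set_integrable lborel {-1..1} (\<lambda>s. coeff r j * (poly ?P s * ((1 + s) / 2) ^ j * (1 - s\<^sup>2) powr \<beta>))" for j
    using set_integrable_jacobi [OF \<beta>, of "?P * [:1/2, 1/2:] ^ j"]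
    by (intro set_integrable_mult_right) (simp add: add_divide_distrib mult.commute)
  then have "(LBINT s:{-1..1}. (\<Sum>j\<le>degree q. coeff r j * (poly ?P s * ((1 + s) / 2) ^ j * (1 - s\<^sup>2) powr \<beta>))) =
     (\<Sum>j\<le>degree q. coeff r j * (LBINT s:{-1..1}. poly ?P s * ((1 + s) / 2) ^ j * (1 - s\<^sup>2) powr \<beta>))"
    unfolding set_lebesgue_integral_def set_integrable_def scaleR_sum_right
    by (subst Bochner_Integration.integral_sum) (auto simp: mult.left_commute [of _ "coeff r _"])
  also have "\<dots> = 0"
    using q by (intro sum.neutral ballI) (subst jacobi_orthogonal_monomial, auto intro: \<beta>)
  finally show ?thesis
    by (simp add: q_eq sum_distrib_left sum_distrib_right mult_ac)
qed

text \<open>A zero integral would force the integrand to vanish almost everywhere. Inside the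
  interval it vanishes only at the finitely many roots of \<open>p\<close>, so the open interval
  would be a null set.\<close>

lemma jacobi_integral_pos:
  fixes \<beta> :: real and p :: "real poly"
  assumes \<beta>: "\<beta> > -1" and "p \<noteq> 0" and nonneg: "\<And>s. s \<in> {-1..1} \<Longrightarrow> poly p s \<ge> 0"
  shows "(LBINT s:{-1..1}. poly p s * (1 - s\<^sup>2) powr \<beta>) > 0"
proof -
  let ?f = "\<lambda>s. indicator {-1..1} s *\<^sub>R (poly p s * (1 - s\<^sup>2) powr \<beta>)"
  have f0: "?f s \<ge> 0" for s
    using nonneg by (simp add: indicator_def)
  have int: "integrable lborel ?f"
    using set_integrable_jacobi [OF \<beta>] by (simp add: set_integrable_def)
  have "integral\<^sup>L lborel ?f \<noteq> 0"
  proof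
    assume "integral\<^sup>L lborel ?f = 0"
    then have "AE s in lborel. ?f s = 0"
      using integral_nonneg_eq_0_iff_AE [OF int] f0 by simp
    moreover have "AE s in lborel. s \<notin> {s. poly p s = 0}"
      using poly_roots_finite [OF \<open>p \<noteq> 0\<close>]
      by (intro AE_not_in finite_imp_null_set_lborel)
    ultimately have "AE s in lborel. s \<notin> {-1<..<1::real}"
    proof eventually_elim
      case (elim s)
      show ?case
      proof
        assume "s \<in> {-1<..<1}"
        then have "s\<^sup>2 < 1" by (simp add: abs_square_less_1 abs_less_iff)
        with elim \<open>s \<in> {-1<..<1}\<close> show False by (auto simp: indicator_def)
      qed
    qed
    then have "{-1<..<1::real} \<in> null_sets lborel"
      by (subst AE_iff_null_sets) auto
    then show False by (simp add: null_sets_def)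
  qed
  moreover have "integral\<^sup>L lborel ?f \<ge> 0"
    using f0 by (intro integral_nonneg_AE AE_I2)
  ultimately show ?thesis
    by (simp add: set_lebesgue_integral_def)
qed

section \<open>Zeros of the Jacobi polynomials\<close>

lemma prod_linear_dvd:
  fixes p :: "'a :: idom poly"
  assumes "finite Z" "\<And>z. z \<in> Z \<Longrightarrow> poly p z = 0"
  shows "(\<Prod>z\<in>Z. [:-z, 1:]) dvd p"
  using assms
proof (induction Z arbitrary: p rule: finite_induct)
  case (insert z Z)
  then have "[:-z, 1:] dvd p" by (simp add: poly_eq_0_iff_dvd)
  then obtain q where q: "p = [:-z, 1:] * q" by (elim dvdE)
  have "poly q y = 0" if "y \<in> Z" for y
    using insert.prems [of y] that insert.hyps by (auto simp: q)
  then have "(\<Prod>z\<in>Z. [:-z, 1:]) dvd q" by (rule insert.IH)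
  then show ?case
    using insert.hyps by (simp add: q mult_dvd_mono del: mult_pCons_left)
qed simp

lemma degree_prod_linear:
  "degree (\<Prod>z\<in>Z. [:-z, 1 :: 'a :: idom:]) = card Z"
  by (simp add: degree_prod_sum_eq)

lemma poly_no_root_one_signed:
  fixes p :: "real poly"
  assumes "\<And>s. poly p s \<noteq> 0"
  shows "(\<forall>s. poly p s \<ge> 0) \<or> (\<forall>s. poly p s \<le> 0)"
proof (rule ccontr)
  assume "\<not> ?thesis"
  then obtain a b where ab: "poly p a < 0" "poly p b > 0" by (auto simp: not_le)
  have "a \<noteq> b" using ab by auto
  then consider "a < b" | "b < a" by linarith
  then show False
    using poly_IVT_pos [of a b p] poly_IVT_neg [of b a p] ab assms by cases auto
qed

text \<open>
  If \<open>degree Q < N\<close>, then \<open>Q\<close> is orthogonal to \<open>Q H\<close>, although \<open>Q\<^sup>2 H\<close> does not change sign. This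
  excludes double roots, roots outside \<open>(-1, 1)\<close> and factors without real roots.
\<close>

lemma jacobi_poly_factor_degree:
  fixes \<beta> :: real
  assumes \<beta>: "\<beta> > -1" and eq: "jacobi_poly N \<beta> \<beta> = Q * H"
    and H: "(\<forall>s\<in>{-1..1}. poly H s \<ge> 0) \<or> (\<forall>s\<in>{-1..1}. poly H s \<le> 0)"
  shows "degree Q \<ge> N"
proof (rule ccontr)
  assume "\<not> degree Q \<ge> N"
  then have zero: "(LBINT s:{-1..1}. poly (Q * H * Q) s * (1 - s\<^sup>2) powr \<beta>) = 0"
    unfolding eq [symmetric] by (intro jacobi_orthogonal \<beta>) simp
  have nz: "Q * H * Q \<noteq> 0"
    using jacobi_poly_nonzero [OF \<beta>, of N \<beta>] by (auto simp: eq)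
  have sq: "poly (Q * H * Q) s = (poly Q s)\<^sup>2 * poly H s" for s
    by (simp add: power2_eq_square)
  from H show False
  proof
    assume "\<forall>s\<in>{-1..1}. poly H s \<ge> 0"
    then have "poly (Q * H * Q) s \<ge> 0" if "s \<in> {-1..1}" for s
      using that by (simp only: sq) simp
    then show False using jacobi_integral_pos [OF \<beta> nz] zero by auto
  next
    assume "\<forall>s\<in>{-1..1}. poly H s \<le> 0"
    then have "poly (- (Q * H * Q)) s \<ge> 0" if "s \<in> {-1..1}" for s
      using that by (simp only: poly_minus sq) (simp add: mult_nonneg_nonpos)
    then show False using jacobi_integral_pos [OF \<beta>, of "- (Q * H * Q)"] nz zero 
      by (auto simp: set_lebesgue_integral_def)
  qed
qed

text \<open>So far the degree is only bounded above by \<open>N\<close>. Equality comes from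
  counting the roots, which is why the claims are proved together.\<close>

lemma
  fixes \<beta> :: real
  assumes \<beta>: "\<beta> > -1"
  shows finite_gauss_jacobi_nodes: "finite (gauss_jacobi_nodes N \<beta>)"
    and card_gauss_jacobi_nodes: "card (gauss_jacobi_nodes N \<beta>) = N"
    and gauss_jacobi_nodes_subset: "gauss_jacobi_nodes N \<beta> \<subseteq> {-1<..<1}"
    and degree_jacobi_poly: "degree (jacobi_poly N \<beta> \<beta>) = N"
proof -
  define P where "P = jacobi_poly N \<beta> \<beta>"
  define Z where "Z = gauss_jacobi_nodes N \<beta>"
  have P0: "P \<noteq> 0" unfolding P_def by (rule jacobi_poly_nonzero [OF \<beta>])
  have dP: "degree P \<le> N" unfolding P_def by (rule degree_jacobi_poly_le)
  have Z: "Z = {z. poly P z = 0}" by (simp add: Z_def P_def gauss_jacobi_nodes_def)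
  have fin: "finite Z" unfolding Z by (rule poly_roots_finite [OF P0])
  define Q where "Q = (\<Prod>z\<in>Z. [:-z, 1:])"
  have "Q dvd P" unfolding Q_def by (rule prod_linear_dvd [OF fin]) (simp add: Z)
  then obtain H where QH: "P = Q * H" by (elim dvdE)
  have key: "degree A \<ge> N" if "P = A * B" "(\<forall>s\<in>{-1..1}. poly B s \<ge> 0) \<or> (\<forall>s\<in>{-1..1}. poly B s \<le> 0)" for A B
    using jacobi_poly_factor_degree [OF \<beta>] that unfolding P_def by blast
  have "poly H z \<noteq> 0" for z
  proof
    assume Hz: "poly H z = 0"
    then have "z \<in> Z" by (simp add: Z QH)
    then have Q': "Q = [:-z, 1:] * (\<Prod>z\<in>Z - {z}. [:-z, 1:])" (is "_ = _ * ?Q'")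
      unfolding Q_def by (rule prod.remove [OF fin])
    from Hz obtain H' where H': "H = [:-z, 1:] * H'" by (auto simp: poly_eq_0_iff_dvd elim: dvdE)
    \<comment> \<open>A root of the cofactor is a double root of \<open>P\<close>. Its square is
      nonnegative, so the other factor, of degree at most \<open>N - 2\<close>, would need degree
      \<open>N\<close>.\<close>
    have eq: "P = (?Q' * H') * [:-z, 1:] ^ 2"
      unfolding QH Q' H' by (simp only: power2_eq_square mult_ac)
    then have "degree (?Q' * H') \<ge> N"
      by (rule key) simp
    moreover have "degree P = degree (?Q' * H') + 2"
      using P0 unfolding eq by (subst degree_mult_eq) (auto simp: degree_power_eq)
    ultimately show False using dP by simp
  qed
  \<comment> \<open>Without real roots \<open>H\<close> has constant sign, so the product over the
    distinct roots alone has degree at least \<open>N\<close>.\<close>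
  then have "degree Q \<ge> N"
    using key [OF QH] poly_no_root_one_signed [of H] by blast
  then have "card Z \<ge> N" by (simp add: Q_def degree_prod_linear)
  moreover have "card Z \<le> degree P" unfolding Z by (rule card_poly_roots_bound [OF P0])
  ultimately have card: "card Z = N" and deg: "degree P = N" using dP by auto
  have "z \<in> {-1<..<1}" if "z \<in> Z" for z
  proof (rule ccontr)
    assume z: "z \<notin> {-1<..<1}"
    from that obtain A where A: "P = A * [:-z, 1:]"
      by (auto simp: Z poly_eq_0_iff_dvd mult.commute [of _ "[:-z, 1:]"] elim!: dvdE)
    \<comment> \<open>The linear factor of a root outside the open interval has constant sign on
      \<open>{-1..1}\<close>.\<close>
    have "degree A \<ge> N"
      using z by (intro key [OF A]) auto
    moreover have "degree P = degree A + 1"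
      using P0 unfolding A by (subst degree_mult_eq) auto
    ultimately show False using deg by simp
  qed
  with fin card deg show "finite (gauss_jacobi_nodes N \<beta>)" "card (gauss_jacobi_nodes N \<beta>) = N"
      "gauss_jacobi_nodes N \<beta> \<subseteq> {-1<..<1}" "degree (jacobi_poly N \<beta> \<beta>) = N"
    by (auto simp: Z_def P_def)
qed

section \<open>Existence and uniqueness of the Gauss weights\<close>

lemma jacobi_integral_add:
  fixes \<beta> :: real
  assumes "\<beta> > -1"
  shows "(LBINT s:{-1..1}. poly (p + q) s * (1 - s\<^sup>2) powr \<beta>) =
    (LBINT s:{-1..1}. poly p s * (1 - s\<^sup>2) powr \<beta>) + (LBINT s:{-1..1}. poly q s * (1 - s\<^sup>2) powr \<beta>)"
  by (subst set_integral_add(2) [symmetric])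
     (simp_all add: set_integrable_jacobi assms distrib_right)

lemma jacobi_integral_sum_smult:
  fixes \<beta> :: real
  assumes "\<beta> > -1" "finite Z"
  shows "(LBINT s:{-1..1}. poly (\<Sum>z\<in>Z. smult (c z) (p z)) s * (1 - s\<^sup>2) powr \<beta>) =
    (\<Sum>z\<in>Z. c z * (LBINT s:{-1..1}. poly (p z) s * (1 - s\<^sup>2) powr \<beta>))"
  using assms(2)
proof induction
  case empty
  then show ?case by (simp add: set_lebesgue_integral_def)
next
  case (insert z Z)
  have "(LBINT s:{-1..1}. poly (smult (c z) (p z)) s * (1 - s\<^sup>2) powr \<beta>) =
      c z * (LBINT s:{-1..1}. poly (p z) s * (1 - s\<^sup>2) powr \<beta>)"
    by (simp add: mult.assoc)
  then show ?case
    using insert by (simp add: jacobi_integral_add assms(1) del: poly_add poly_smult)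
qed

text \<open>The weights are the integrals of the Lagrange basis polynomials \<open>L z\<close>.
  Testing a rule on \<open>L z\<close> gives uniqueness, testing it on the square gives positivity.
  The result makes \<open>gauss_jacobi_weight\<close> a meaningful definite description.\<close>

lemma gauss_quadrature_ex1:
  fixes \<beta> :: real
  assumes \<beta>: "\<beta> > -1" and N: "N > 0"
  defines "Z \<equiv> gauss_jacobi_nodes N \<beta>"
  shows "\<exists>!W. W \<in> extensional Z \<and> (\<forall>z\<in>Z. W z > 0) \<and>
    (\<forall>p :: real poly. degree p \<le> 2 * N - 1 \<longrightarrow>
       (LBINT s:{-1..1}. poly p s * (1 - s\<^sup>2) powr \<beta>) = (\<Sum>z\<in>Z. W z * poly p z))"
proof -
  let ?J = "\<lambda>p. LBINT s:{-1..1}. poly p s * (1 - s\<^sup>2) powr \<beta>"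
  let ?P = "jacobi_poly N \<beta> \<beta>"
  have fin: "finite Z" and card: "card Z = N"
    unfolding Z_def by (rule finite_gauss_jacobi_nodes [OF \<beta>], rule card_gauss_jacobi_nodes [OF \<beta>])
  define L where "L z = smult (inverse (\<Prod>y\<in>Z - {z}. z - y)) (\<Prod>y\<in>Z - {z}. [:-y, 1:])" for z
  have deg_L: "degree (L z) < N" if "z \<in> Z" for z
  proof -
    have "degree (L z) \<le> card (Z - {z})"
      unfolding L_def by (rule order_trans [OF degree_smult_le]) (simp add: degree_prod_linear)
    also have "\<dots> < N" using that fin card N by (simp add: card_Diff_singleton)
    finally show ?thesis .
  qed
  have L_node: "poly (L z) y = (if y = z then 1 else 0)" if "z \<in> Z" "y \<in> Z" for y z
  proof (cases "y = z")
    case True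
    have "(\<Prod>y\<in>Z - {z}. z - y) \<noteq> 0" using fin by (simp add: prod_zero_iff)
    then show ?thesis using True by (simp add: L_def poly_prod)
  next
    case False
    then have "(\<Prod>x\<in>Z - {z}. poly [:-x, 1:] y) = 0"
      using that fin by (intro prod_zero) (auto intro!: bexI [of _ y])
    then show ?thesis using False by (simp add: L_def poly_prod)
  qed
  define W where "W = (\<lambda>z\<in>Z. ?J (L z))"
  have exact: "?J p = (\<Sum>z\<in>Z. W z * poly p z)" if "degree p \<le> 2 * N - 1" for p
  proof -
    \<comment> \<open>The multiple \<open>?P * q\<close> contributes 0 to the integral by
      orthogonality and 0 to the sum because the nodes are roots of \<open>?P\<close>. The remainder
      equals its Lagrange interpolant.\<close>
    define q r where "q = p div ?P" and "r = p mod ?P"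
    have p: "p = ?P * q + r" by (simp add: q_def r_def)
    have P0: "?P \<noteq> 0" by (rule jacobi_poly_nonzero [OF \<beta>])
    have dP: "degree ?P = N" by (rule degree_jacobi_poly [OF \<beta>])
    have dr: "degree r < N"
      using degree_mod_less [OF P0, of p] dP N by (auto simp: r_def)
    have dq: "degree q < N"
    proof (cases "q = 0")
      case False
      then have "degree (?P * q) = N + degree q"
        using P0 dP by (simp add: degree_mult_eq)
      moreover from this have "degree p = degree (?P * q)"
        unfolding p using dr by (intro degree_add_eq_left) simp
      ultimately show ?thesis using that N by simp
    qed (use N in simp)
    have "r = (\<Sum>z\<in>Z. smult (poly r z) (L z))"
    proof (rule poly_eqI_degree [where A = Z])
      fix y assume "y \<in> Z"
      then have "poly (\<Sum>z\<in>Z. smult (poly r z) (L z)) y = (\<Sum>z\<in>Z. if y = z then poly r z else 0)"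
        unfolding poly_sum by (intro sum.cong) (auto simp: L_node)
      then show "poly r y = poly (\<Sum>z\<in>Z. smult (poly r z) (L z)) y"
        using fin \<open>y \<in> Z\<close> by simp
    next
      have "degree (\<Sum>z\<in>Z. smult (poly r z) (L z)) \<le> N - 1"
        using deg_L fin by (intro degree_sum_le order_trans [OF degree_smult_le]) fastforce+
      then show "card Z > degree (\<Sum>z\<in>Z. smult (poly r z) (L z))" using card N by simp
    qed (use dr card in simp)
    then have "?J r = (\<Sum>z\<in>Z. poly r z * ?J (L z))"
      using jacobi_integral_sum_smult [OF \<beta> fin, of "poly r" L] by simp
    moreover have "?J (?P * q) = 0" by (rule jacobi_orthogonal [OF \<beta> dq])
    moreover have "poly p z = poly r z" if "z \<in> Z" for z
      using that by (subst p) (simp add: Z_def gauss_jacobi_nodes_def)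
    ultimately show ?thesis
      using jacobi_integral_add [OF \<beta>, of "?P * q" r, folded p]
      by (simp add: W_def mult.commute [of "set_lebesgue_integral _ _ _"] del: poly_mult)
  qed
  have L_uniq: "?J (L z) = W' z"
    if "\<And>p. degree p \<le> 2 * N - 1 \<Longrightarrow> ?J p = (\<Sum>z\<in>Z. W' z * poly p z)" "z \<in> Z" for W' z
  proof -
    have "?J (L z) = (\<Sum>y\<in>Z. W' y * poly (L z) y)"
      using deg_L [OF that(2)] by (intro that(1)) simp
    also have "\<dots> = (\<Sum>y\<in>Z. if y = z then W' y else 0)"
      by (intro sum.cong) (auto simp: L_node that(2))
    also have "\<dots> = W' z" using fin that(2) by simp
    finally show ?thesis .
  qed
  have pos: "W z > 0" if z: "z \<in> Z" for z
  proof -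
    \<comment> \<open>The square has degree at most \<open>2 * N - 2\<close>, within the range of
      exactness.\<close>
    have "?J (L z * L z) = (\<Sum>y\<in>Z. W y * poly (L z * L z) y)"
      using deg_L [OF z] degree_mult_le [of "L z" "L z"] by (intro exact) simp
    also have "\<dots> = (\<Sum>y\<in>Z. if y = z then W y else 0)"
      by (intro sum.cong) (auto simp: L_node z)
    also have "\<dots> = W z" using fin z by simp
    finally have "W z = ?J (L z * L z)" by simp
    moreover have "L z \<noteq> 0" using L_node [OF z z] by auto
    ultimately show ?thesis using jacobi_integral_pos [OF \<beta>, of "L z * L z"] by simp
  qed
  show ?thesis
  proof (rule ex1I [of _ W])
    show "W \<in> extensional Z \<and> (\<forall>z\<in>Z. W z > 0) \<and>
      (\<forall>p :: real poly. degree p \<le> 2 * N - 1 \<longrightarrow> ?J p = (\<Sum>z\<in>Z. W z * poly p z))"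
      using pos exact by (simp add: W_def)
  next
    fix W' assume W': "W' \<in> extensional Z \<and> (\<forall>z\<in>Z. W' z > 0) \<and>
      (\<forall>p :: real poly. degree p \<le> 2 * N - 1 \<longrightarrow> ?J p = (\<Sum>z\<in>Z. W' z * poly p z))"
    show "W' = W"
    proof (rule extensionalityI [of _ Z])
      show "W' z = W z" if "z \<in> Z" for z
        using L_uniq [of W' z] W' that by (simp add: W_def)
    qed (use W' in \<open>auto simp: W_def\<close>)
  qed
qed

lemma
  fixes \<beta> :: real
  assumes \<beta>: "\<beta> > -1" and N: "N > 0"
  shows gauss_jacobi_weight_pos: "z \<in> gauss_jacobi_nodes N \<beta> \<Longrightarrow> gauss_jacobi_weight N \<beta> z > 0"
    and gauss_jacobi_quadrature: "degree p \<le> 2 * N - 1 \<Longrightarrow>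
      (LBINT s:{-1..1}. poly p s * (1 - s\<^sup>2) powr \<beta>) =
      (\<Sum>z\<in>gauss_jacobi_nodes N \<beta>. gauss_jacobi_weight N \<beta> z * poly p z)"
  using theI' [OF gauss_quadrature_ex1 [OF assms]] unfolding gauss_jacobi_weight_def by auto

subsection \<open>Regular polygons\<close>

text \<open>A geometric sum over powers of a \<open>K\<close>-th root of unity; the bounds on
  \<open>m\<close> exclude the root 1.\<close>

lemma sum_cis_multiples_eq_0:
  fixes m :: int
  assumes "m \<noteq> 0" "\<bar>m\<bar> < int K"
  shows "(\<Sum>j<K. cis (of_int m * (2 * pi * real j / real K))) = 0"
proof -
  define z where "z = cis (2 * pi * of_int m / real K)"
  have K: "K > 0" using assms by simp
  have "z ^ K = cis (real K * (2 * pi * of_int m / real K))"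
    unfolding z_def by (rule Complex.DeMoivre)
  also have "\<dots> = 1" using K by (simp add: cis_multiple_2pi)
  finally have "z ^ K = 1" .
  moreover have "z \<noteq> 1"
  proof
    assume "z = 1"
    then have "cos (2 * pi * of_int m / real K) = 1"
      unfolding z_def by (metis cis.sel(1) one_complex.sel(1))
    then obtain n :: int where "2 * pi * of_int m / real K = of_int n * 2 * pi"
      by (auto simp: cos_one_2pi_int)
    then have "real_of_int m = real_of_int (n * int K)"
      using K by (simp add: field_simps)
    then have m: "m = n * int K" by linarith
    then have "1 \<le> \<bar>n\<bar>" using assms(1) by auto
    then have "int K \<le> \<bar>m\<bar>" by (simp add: m abs_mult mult_le_cancel_right1)
    with assms(2) show False by simp
  qed
  ultimately have "(\<Sum>j<K. z ^ j) = 0"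
    by (simp add: sum_gp_strict)
  moreover have "cis (of_int m * (2 * pi * real j / real K)) = z ^ j" for j
    by (simp add: z_def Complex.DeMoivre mult_ac)
  ultimately show ?thesis by simp
qed

text \<open>A Laurent polynomial in \<open>cis \<theta>\<close>, encoded as an ordinary polynomial
  shifted by \<open>a + b\<close>: the coefficient with index \<open>i\<close> belongs to the
  frequency \<open>i - (a + b)\<close>.\<close>

lemma trig_monomial_eq_Laurent:
  "\<exists>p :: complex poly. \<forall>\<theta>. complex_of_real (cos \<theta> ^ a * sin \<theta> ^ b) =
    (\<Sum>i\<le>2 * (a + b). coeff p i * cis (of_int (int i - int (a + b)) * \<theta>))"
proof -
  \<comment> \<open>Euler's formulas for cosine and sine with \<open>cis (- \<theta>)\<close>
    factored out.\<close>
  let ?p = "[:1/2, 0, 1/2:] ^ a * [:\<i>/2, 0, -\<i>/2:] ^ b"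
  have "degree ?p \<le> degree [:1/2, 0, 1/2 :: complex:] * a + degree [:\<i>/2, 0, -\<i>/2:] * b"
    by (intro order_trans [OF degree_mult_le] add_mono degree_power_le)
  then have deg: "degree ?p \<le> 2 * (a + b)" by simp
  have "complex_of_real (cos \<theta> ^ a * sin \<theta> ^ b) =
    (\<Sum>i\<le>2 * (a + b). coeff ?p i * cis (of_int (int i - int (a + b)) * \<theta>))" for \<theta>
  proof -
    have inv: "cis (- \<theta>) * (cis \<theta> * x) = x" for x
      by (simp add: mult.assoc [symmetric] cis_mult)
    have c: "complex_of_real (cos \<theta>) = cis (- \<theta>) * poly [:1/2, 0, 1/2:] (cis \<theta>)"
      by (simp add: distrib_left right_diff_distrib inv) (simp add: complex_eq_iff)
    have s: "complex_of_real (sin \<theta>) = cis (- \<theta>) * poly [:\<i>/2, 0, -\<i>/2:] (cis \<theta>)"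
      by (simp add: distrib_left right_diff_distrib inv) (simp add: complex_eq_iff)
    have "complex_of_real (cos \<theta> ^ a * sin \<theta> ^ b) = cis (- \<theta>) ^ (a + b) * poly ?p (cis \<theta>)"
      unfolding of_real_mult of_real_power c s by (simp only: power_mult_distrib power_add poly_mult poly_power mult_ac)
    also have "poly ?p (cis \<theta>) = (\<Sum>i\<le>2 * (a + b). coeff ?p i * cis \<theta> ^ i)"
      unfolding poly_altdef using deg
      by (intro sum.mono_neutral_left) (auto simp: coeff_eq_0 not_le)
    also have "cis (- \<theta>) ^ (a + b) * \<dots> = (\<Sum>i\<le>2 * (a + b). coeff ?p i * cis (of_int (int i - int (a + b)) * \<theta>))"
    proof -
      have "cis (- \<theta>) ^ (a + b) * cis \<theta> ^ i = cis (of_int (int i - int (a + b)) * \<theta>)" for i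
        unfolding Complex.DeMoivre cis_mult by (simp add: algebra_simps)
      then show ?thesis
        unfolding sum_distrib_left mult.left_commute [of "cis (- \<theta>) ^ (a + b)"] by simp
    qed
    finally show ?thesis .
  qed
  then show ?thesis by blast
qed

text \<open>All frequencies are at most \<open>a + b < K\<close> in absolute value, so summation
  leaves only frequency 0, which does not see \<open>\<phi>\<close>.\<close>

lemma trig_monomial_sum_rotate:
  assumes "a + b < K"
  shows "(\<Sum>j<K. cos (\<phi> + 2 * pi * real j / real K) ^ a * sin (\<phi> + 2 * pi * real j / real K) ^ b) =
    (\<Sum>j<K. cos (2 * pi * real j / real K) ^ a * sin (2 * pi * real j / real K) ^ b)"
proof -
  obtain p :: "complex poly" where p: "\<And>\<theta>. complex_of_real (cos \<theta> ^ a * sin \<theta> ^ b) =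
    (\<Sum>i\<le>2 * (a + b). coeff p i * cis (of_int (int i - int (a + b)) * \<theta>))"
    using trig_monomial_eq_Laurent [of a b] by blast
  have "complex_of_real (\<Sum>j<K. cos (\<phi> + 2 * pi * real j / real K) ^ a * sin (\<phi> + 2 * pi * real j / real K) ^ b) =
      of_nat K * coeff p (a + b)" for \<phi>
  proof -
    have "complex_of_real (\<Sum>j<K. cos (\<phi> + 2 * pi * real j / real K) ^ a * sin (\<phi> + 2 * pi * real j / real K) ^ b) =
      (\<Sum>i\<le>2 * (a + b). \<Sum>j<K. coeff p i * cis (of_int (int i - int (a + b)) * (\<phi> + 2 * pi * real j / real K)))"
      unfolding of_real_sum p by (rule sum.swap)
    also have "\<dots> = (\<Sum>i\<le>2 * (a + b). coeff p i * cis (of_int (int i - int (a + b)) * \<phi>) *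
         (\<Sum>j<K. cis (of_int (int i - int (a + b)) * (2 * pi * real j / real K))))"
      by (simp add: sum_distrib_left cis_mult distrib_left mult.assoc)
    also have "\<dots> = (\<Sum>i\<le>2 * (a + b). if i = a + b then coeff p i * of_nat K else 0)"
    proof (intro sum.cong refl)
      fix i assume "i \<in> {..2 * (a + b)}"
      then show "coeff p i * cis (of_int (int i - int (a + b)) * \<phi>) *
         (\<Sum>j<K. cis (of_int (int i - int (a + b)) * (2 * pi * real j / real K))) =
         (if i = a + b then coeff p i * of_nat K else 0)"
        using sum_cis_multiples_eq_0 [of "int i - int (a + b)" K] assms by auto
    qed
    also have "\<dots> = of_nat K * coeff p (a + b)" by simp
    finally show ?thesis .
  qed
  from this [of \<phi>] this [of 0] show ?thesis
    unfolding of_real_eq_iff [where 'a = complex, symmetric] by simp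
qed

definition polygon_sum :: "nat \<Rightarrow> nat \<Rightarrow> nat \<Rightarrow> real" where
  "polygon_sum K a b = (\<Sum>j<K. cos (2 * pi * real j / real K) ^ a * sin (2 * pi * real j / real K) ^ b)"

text \<open>
  By \<open>trig_monomial_sum_rotate\<close>, the derivative of the rotated sum with respect to the angle is 0.
\<close>

lemma polygon_sum_deriv:
  assumes "a + b < K"
  shows "real b * polygon_sum K (a + 1) (b - 1) = real a * polygon_sum K (a - 1) (b + 1)"
proof -
  let ?\<theta> = "\<lambda>j. 2 * pi * real j / real K"
  let ?F = "\<lambda>\<phi>. \<Sum>j<K. cos (\<phi> + ?\<theta> j) ^ a * sin (\<phi> + ?\<theta> j) ^ b"
  \<comment> \<open>The truncated exponents \<open>b - 1\<close> and \<open>a - 1\<close> are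
    harmless since they occur with the factors \<open>b\<close> and \<open>a\<close>.\<close>
  have "(?F has_real_derivative (\<Sum>j<K.
      real b * (cos (0 + ?\<theta> j) ^ (a + 1) * sin (0 + ?\<theta> j) ^ (b - 1)) -
      real a * (cos (0 + ?\<theta> j) ^ (a - 1) * sin (0 + ?\<theta> j) ^ (b + 1)))) (at 0)"
    by (auto intro!: derivative_eq_intros sum.cong simp: algebra_simps)
  moreover have "(?F has_real_derivative 0) (at 0)"
    unfolding trig_monomial_sum_rotate [OF assms] by simp
  ultimately have "(\<Sum>j<K.
      real b * (cos (0 + ?\<theta> j) ^ (a + 1) * sin (0 + ?\<theta> j) ^ (b - 1)) -
      real a * (cos (0 + ?\<theta> j) ^ (a - 1) * sin (0 + ?\<theta> j) ^ (b + 1))) = 0"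
    by (rule DERIV_unique)
  then show ?thesis
    by (simp add: polygon_sum_def sum_subtractf sum_distrib_left)
qed

lemma polygon_sum_square:
  "polygon_sum K (a + 2) b + polygon_sum K a (b + 2) = polygon_sum K a b"
proof -
  have "c ^ (a + 2) * s ^ b + c ^ a * s ^ (b + 2) = c ^ a * s ^ b" if "s\<^sup>2 + c\<^sup>2 = 1" for c s :: real
  proof -
    have "c ^ (a + 2) * s ^ b + c ^ a * s ^ (b + 2) = c ^ a * s ^ b * (s\<^sup>2 + c\<^sup>2)"
      unfolding power_add by (simp only: ring_distribs mult_ac)
    then show ?thesis by (simp add: that)
  qed
  then show ?thesis
    unfolding polygon_sum_def sum.distrib [symmetric] by simp
qed

lemma gaussian_moment_Suc_Suc: "gaussian_moment (a + 2) = (real a + 1) / 2 * gaussian_moment a"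
  using Gamma_plus1 [of "(real a + 1) / 2"] nonpos_Ints_nonpos [of "(real a + 1) / 2"]
  by (force simp: gaussian_moment_def add_divide_distrib)

text \<open>The polygon sums are never compared with an integral. \<open>polygon_sum_deriv\<close>
  and \<open>polygon_sum_square\<close> give a recursion lowering one exponent by 2, and the Gamma
  quotient satisfies the same recursion; exponents 0 and 1 are the base cases.\<close>

lemma polygon_sum_eq:
  assumes "a + b < K"
  shows "polygon_sum K a b =
    real K / pi * (gaussian_moment a * gaussian_moment b / Gamma (real (a + b + 2) / 2))"
  using assms
proof (induction "a + b" arbitrary: a b rule: less_induct)
  case less
  have Gamma_rec: "Gamma (real (a + b + 2 + 2) / 2) = real (a + b + 2) / 2 * Gamma (real (a + b + 2) / 2)" for a b :: nat
    using Gamma_plus1 [of "real (a + b + 2) / 2"] nonpos_Ints_nonpos [of "real (a + b + 2) / 2"]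
    by (force simp: add_divide_distrib)
  have arith: "x / y * (k * (g * h / G)) = k * ((x / 2 * g) * h / (y / 2 * G))" for x y k g h G :: real
    by simp
  consider "a = 0" "b = 0" | "a = 1" | "b = 1" | c where "a = c + 2" | c where "b = c + 2"
  proof -
    have "a = 0 \<and> b = 0 \<or> a = 1 \<or> b = 1 \<or> (\<exists>c. a = c + 2) \<or> (\<exists>c. b = c + 2)"
      by presburger
    with that show thesis by blast
  qed
  then show ?case
  proof cases
    case 1
    then show ?thesis by (simp add: polygon_sum_def gaussian_moment_def Gamma_one_half_real)
  next
    case 2
    \<comment> \<open>With first exponent 0 the derivative identity says that \<open>b + 1\<close>
      times the sum is 0.\<close>
    then show ?thesis using polygon_sum_deriv [of 0 "b + 1" K] less.prems by (simp add: gaussian_moment_def)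
  next
    case 3
    then show ?thesis using polygon_sum_deriv [of "a + 1" 0 K] less.prems by (simp add: gaussian_moment_def)
  next
    case (4 c)
    \<comment> \<open>The derivative identity at \<open>(c + 1, b + 1)\<close> relates the sums at
      \<open>(c + 2, b)\<close> and \<open>(c, b + 2)\<close>; the square identity eliminates the
      latter.\<close>
    have "real (c + b + 2) * polygon_sum K a b = (real c + 1) * polygon_sum K c b"
      using polygon_sum_deriv [of "c + 1" "b + 1" K] polygon_sum_square [of K c b] less.prems
      by (simp add: 4) (simp add: algebra_simps flip: polygon_sum_square [of K c b])
    then have "polygon_sum K a b = (real c + 1) / real (c + b + 2) * polygon_sum K c b"
      by (simp add: field_simps)
    also have "polygon_sum K c b =
        real K / pi * (gaussian_moment c * gaussian_moment b / Gamma (real (c + b + 2) / 2))"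
      using less.prems by (intro less.hyps) (auto simp: 4)
    also have "(real c + 1) / real (c + b + 2) * \<dots> = real K / pi * (((real c + 1) / 2 * gaussian_moment c) *
        gaussian_moment b / (real (c + b + 2) / 2 * Gamma (real (c + b + 2) / 2)))"
      by (rule arith)
    also have "\<dots> = real K / pi * (gaussian_moment a * gaussian_moment b / Gamma (real (a + b + 2) / 2))"
      unfolding Gamma_rec [symmetric] 4 gaussian_moment_Suc_Suc by (simp only: add_ac)
    finally show ?thesis .
  next
    case (5 c)
    have "real (a + c + 2) * polygon_sum K a b = (real c + 1) * polygon_sum K a c"
      using polygon_sum_deriv [of "a + 1" "c + 1" K] polygon_sum_square [of K a c] less.prems
      by (simp add: 5) (simp add: algebra_simps flip: polygon_sum_square [of K a c])
    then have "polygon_sum K a b = (real c + 1) / real (a + c + 2) * polygon_sum K a c"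
      by (simp add: field_simps)
    also have "polygon_sum K a c =
        real K / pi * (gaussian_moment a * gaussian_moment c / Gamma (real (a + c + 2) / 2))"
      using less.prems by (intro less.hyps) (auto simp: 5)
    also have "(real c + 1) / real (a + c + 2) * \<dots> = real K / pi * (gaussian_moment a *
        ((real c + 1) / 2 * gaussian_moment c) / (real (a + c + 2) / 2 * Gamma (real (a + c + 2) / 2)))"
      using arith [of _ _ _ "gaussian_moment c" "gaussian_moment a"] by (simp only: mult_ac)
    also have "\<dots> = real K / pi * (gaussian_moment a * gaussian_moment b / Gamma (real (a + b + 2) / 2))"
      unfolding Gamma_rec [symmetric] 5 gaussian_moment_Suc_Suc by (simp only: add_ac)
    finally show ?thesis .
  qed
qed

lemma inj_on_polygon:
  "inj_on (\<lambda>j. \<lambda>i\<in>{..<2::nat}. if i = 0 then cos (2 * pi * real j / real k) else sin (2 * pi * real j / real k)) {..<k}"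
proof (rule inj_onI)
  fix i j assume ij: "i \<in> {..<k}" "j \<in> {..<k}"
    and eq: "(\<lambda>l\<in>{..<2::nat}. if l = 0 then cos (2 * pi * real i / real k) else sin (2 * pi * real i / real k)) =
       (\<lambda>l\<in>{..<2}. if l = 0 then cos (2 * pi * real j / real k) else sin (2 * pi * real j / real k))"
  have "cos (2 * pi * real i / real k) = cos (2 * pi * real j / real k)"
    "sin (2 * pi * real i / real k) = sin (2 * pi * real j / real k)"
    using fun_cong [OF eq, of 0] fun_cong [OF eq, of 1] by simp_all
  then obtain n :: int where "2 * pi * real i / real k = 2 * pi * real j / real k + 2 * pi * of_int n"
    using sin_cos_eq_iff by metis
  then have "2 * pi * real i = 2 * pi * (real j + of_int n * real k)"
    using ij by (simp add: field_simps)
  then have "real_of_int (int i) = real_of_int (int j + n * int k)"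
    by simp
  then have "int i = int j + n * int k" by linarith
  then have "int i mod int k = int j mod int k" by simp
  then show "i = j" using ij by simp
qed

lemma card_polygon_vertices: "card (polygon_vertices k) = k"
  unfolding polygon_vertices_def by (simp add: card_image inj_on_polygon)

lemma polygon_vertices_subset: "polygon_vertices k \<subseteq> unit_sphere 2"
proof
  fix x assume "x \<in> polygon_vertices k"
  then obtain \<theta> where "x = (\<lambda>i\<in>{..<2}. if i = 0 then cos \<theta> else sin \<theta>)"
    by (auto simp: polygon_vertices_def)
  then show "x \<in> unit_sphere 2"
    by (simp add: unit_sphere_def L2_set_def numeral_2_eq_2)
qed

lemma polygon_vertices_sum:
  "(\<Sum>x\<in>polygon_vertices k. x 0 ^ a * x 1 ^ b) = polygon_sum k a b"
  unfolding polygon_vertices_def polygon_sum_def by (simp add: sum.reindex inj_on_polygon)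

subsection \<open>The product rule\<close>

text \<open>The restriction of the complex formula, used to convert \<open>Beta z z\<close> into
  \<open>Beta (1 / 2) z\<close>.\<close>

lemma Gamma_legendre_duplication_real:
  fixes z :: real
  assumes "z > 0"
  shows "Gamma z * Gamma (z + 1 / 2) = 2 powr (1 - 2 * z) * sqrt pi * Gamma (2 * z)"
proof -
  have nonpos: "complex_of_real x \<notin> \<int>\<^sub>\<le>\<^sub>0" if "x > 0" for x
    using that by (auto simp: nonpos_Ints_def complex_eq_iff)
  have "complex_of_real (Gamma z * Gamma (z + 1 / 2)) =
      complex_of_real (2 powr (1 - 2 * z) * sqrt pi * Gamma (2 * z))"
    using Gamma_legendre_duplication [of "of_real z"] nonpos [of z] nonpos [of "z + 1 / 2"] assms
    by (simp add: powr_def exp_of_real [symmetric] Gamma_complex_of_real [symmetric])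
  then show ?thesis by (simp only: of_real_eq_iff)
qed

text \<open>Odd powers cancel by reflection. For even powers,
  \<open>s\<^sup>2 = 1 - (1 - s\<^sup>2)\<close> writes the next integral as a difference of those
  for \<open>\<gamma>\<close> and \<open>\<gamma> + 1\<close>, hence the induction with
  \<open>\<gamma>\<close> arbitrary; the Beta function obeys the same rule.\<close>

lemma jacobi_integral_power:
  fixes \<gamma> :: real
  assumes "\<gamma> > -1"
  shows "(LBINT s:{-1..1}. s ^ k * (1 - s\<^sup>2) powr \<gamma>) =
    (if even k then Beta ((real k + 1) / 2) (\<gamma> + 1) else 0)"
proof (cases "even k")
  case True
  have "(LBINT s:{-1..1}. s ^ (2 * j) * (1 - s\<^sup>2) powr \<gamma>) = Beta (real j + 1 / 2) (\<gamma> + 1)" for j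
    using assms
  proof (induction j arbitrary: \<gamma>)
    case 0
    define z where "z = \<gamma> + 1"
    have z: "z > 0" using 0 by (simp add: z_def)
    have "(LBINT s:{-1..1}. s ^ (2 * 0) * (1 - s\<^sup>2) powr \<gamma>) = 2 * 4 powr \<gamma> * Beta z z"
      using jacobi_integral_monomial [OF 0, of 0 0]
      by (simp add: set_lebesgue_integral_def has_bochner_integral_iff z_def)
    also have "2 * 4 powr \<gamma> = (2 :: real) powr (2 * z - 1)"
      by (simp add: z_def powr_def exp_add ring_distribs ln_realpow [of 2 2, simplified])
    also have "2 powr (2 * z - 1) * Beta z z = Beta (1 / 2) z"
    proof -
      define p where "p = (2 :: real) powr (1 - 2 * z)"
      define A B C where "A = Gamma z" and "B = Gamma (z + 1 / 2)" and "C = Gamma (2 * z)"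
      have pos: "A > 0" "B > 0" "C > 0" "p > 0"
        using z by (auto simp: A_def B_def C_def p_def intro!: Gamma_real_pos)
      have "A * B = p * sqrt pi * C"
        unfolding A_def B_def C_def p_def by (rule Gamma_legendre_duplication_real [OF z])
      then have "A / C = p * sqrt pi / B"
        using pos by (simp add: field_simps)
      moreover have "(2 :: real) powr (2 * z - 1) = 1 / p"
        unfolding p_def powr_minus_divide [symmetric] by simp
      moreover have "A * A / C = A * (A / C)" by simp
      ultimately have "2 powr (2 * z - 1) * (A * A / C) = sqrt pi * A / B"
        using pos by (simp only:) simp
      then show ?thesis
        by (simp add: Beta_def A_def B_def C_def Gamma_one_half_real add.commute)
    qed
    finally show ?case by (simp add: z_def)
  next
    case (Suc j)
    have int: "set_integrable lborel {-1..1} (\<lambda>s. s ^ (2 * j) * (1 - s\<^sup>2) powr \<delta>)" if "\<delta> > -1" for \<delta> :: real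
      using set_integrable_jacobi [OF that, of "monom 1 (2 * j)"] by (simp add: poly_monom)
    have "(LBINT s:{-1..1}. s ^ (2 * Suc j) * (1 - s\<^sup>2) powr \<gamma>) =
        (LBINT s:{-1..1}. s ^ (2 * j) * (1 - s\<^sup>2) powr \<gamma> - s ^ (2 * j) * (1 - s\<^sup>2) powr (\<gamma> + 1))"
    proof (rule set_lebesgue_integral_cong)
      show "\<forall>s. s \<in> {-1..1} \<longrightarrow> s ^ (2 * Suc j) * (1 - s\<^sup>2) powr \<gamma> =
          s ^ (2 * j) * (1 - s\<^sup>2) powr \<gamma> - s ^ (2 * j) * (1 - s\<^sup>2) powr (\<gamma> + 1)"
      proof (intro allI impI)
        fix s :: real assume "s \<in> {-1..1}"
        then have "1 - s\<^sup>2 \<ge> 0" by (simp add: abs_square_le_1 abs_le_iff)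
        then have "(1 - s\<^sup>2) powr (\<gamma> + 1) = (1 - s\<^sup>2) powr \<gamma> * (1 - s\<^sup>2)"
          by (simp add: powr_add)
        moreover have "s ^ (2 * Suc j) = s ^ (2 * j) * s\<^sup>2" by (simp add: power2_eq_square)
        ultimately show "s ^ (2 * Suc j) * (1 - s\<^sup>2) powr \<gamma> =
          s ^ (2 * j) * (1 - s\<^sup>2) powr \<gamma> - s ^ (2 * j) * (1 - s\<^sup>2) powr (\<gamma> + 1)"
          by (simp only:) (simp add: algebra_simps)
      qed
    qed simp
    also have "\<dots> = Beta (real j + 1 / 2) (\<gamma> + 1) - Beta (real j + 1 / 2) (\<gamma> + 1 + 1)"
      using Suc.prems by (subst set_integral_diff(2)) (auto simp: int Suc.IH)
    also have "\<dots> = Beta (real (Suc j) + 1 / 2) (\<gamma> + 1)"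
      using Beta_plus1_plus1 [of "real j + 1 / 2" "\<gamma> + 1"] Suc.prems
        nonpos_Ints_nonpos [of "real j + 1 / 2"] nonpos_Ints_nonpos [of "\<gamma> + 1"]
      by (force simp: add_ac)
    finally show ?case .
  qed
  from this [of "k div 2"] True show ?thesis
    by (auto elim!: evenE simp: add_divide_distrib)
next
  case False
  have "(LBINT s:{-1..1}. s ^ k * (1 - s\<^sup>2) powr \<gamma>) = (LBINT s:{s. - s \<in> {-1..1}}. (- s) ^ k * (1 - (- s)\<^sup>2) powr \<gamma>)"
    by (rule set_integral_reflect)
  also have "{s :: real. - s \<in> {-1..1}} = {-1..1}" by auto
  also have "(LBINT s:{-1..1}. (- s) ^ k * (1 - (- s)\<^sup>2) powr \<gamma>) = - (LBINT s:{-1..1}. s ^ k * (1 - s\<^sup>2) powr \<gamma>)"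
    using False by (simp add: power_minus_odd set_lebesgue_integral_def)
  finally show ?thesis using False by simp
qed

text \<open>The Beta value carries \<open>Gamma (real (n + e) / 2)\<close> in its numerator, where
  \<open>e\<close> is the degree in the later variables; it cancels the denominator of the lower
  moment.\<close>

lemma sphere_moment_Suc:
  assumes "n > 0"
  shows "sphere_moment (Suc n) a =
    (LBINT s:{-1..1}. s ^ a 0 * (1 - s\<^sup>2) powr (real (\<Sum>i<n. a (Suc i)) / 2 + (real (Suc n) - 3) / 2)) *
    sphere_moment n (\<lambda>i. a (Suc i))"
proof -
  define e where "e = (\<Sum>i<n. a (Suc i))"
  let ?\<gamma> = "real e / 2 + (real (Suc n) - 3) / 2"
  have "?\<gamma> > -1" using assms by (simp add: field_simps)
  then have "(LBINT s:{-1..1}. s ^ a 0 * (1 - s\<^sup>2) powr ?\<gamma>) =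
      gaussian_moment (a 0) * Gamma (real (n + e) / 2) / Gamma (real (Suc n + (a 0 + e)) / 2)"
  proof (subst jacobi_integral_power)
    have 1: "?\<gamma> + 1 = real (n + e) / 2" by (simp add: field_simps)
    have 2: "(real (a 0) + 1) / 2 + real (n + e) / 2 = real (Suc n + (a 0 + e)) / 2" by (simp add: field_simps)
    show "(if even (a 0) then Beta ((real (a 0) + 1) / 2) (?\<gamma> + 1) else 0) =
      gaussian_moment (a 0) * Gamma (real (n + e) / 2) / Gamma (real (Suc n + (a 0 + e)) / 2)"
      unfolding 1 Beta_def 2 gaussian_moment_def by simp
  qed
  moreover have "Gamma (real (n + e) / 2) > 0"
    using assms by (intro Gamma_real_pos half_gt_zero of_nat_0_less_iff [THEN iffD2]) simp
  moreover have "(\<Sum>i<Suc n. a i) = a 0 + e"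
    unfolding e_def by (rule sum.lessThan_Suc_shift)
  moreover have "(\<Prod>i<Suc n. gaussian_moment (a i)) = gaussian_moment (a 0) * (\<Prod>i<n. gaussian_moment (a (Suc i)))"
    by (rule prod.lessThan_Suc_shift)
  ultimately show ?thesis
    unfolding sphere_moment_def e_def [symmetric] by simp
qed

lemma sphere_moment_odd:
  assumes "odd (\<Sum>i<n. a i)"
  shows "sphere_moment n a = 0"
proof -
  have "\<exists>i<n. odd (a i)" using assms by (meson dvd_sum lessThan_iff)
  then show ?thesis
    by (auto simp: sphere_moment_def gaussian_moment_def intro!: prod_zero)
qed

section \<open>Lifting points to the next sphere\<close>

lemma lift_point_nth [simp]:
  "lift_point (Suc m) z y 0 = z"
  "i < m \<Longrightarrow> lift_point (Suc m) z y (Suc i) = sqrt (1 - z\<^sup>2) * y i"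
  by (simp_all add: lift_point_def)

lemma lift_point_in_unit_sphere:
  assumes "\<bar>z\<bar> \<le> 1" "y \<in> unit_sphere m"
  shows "lift_point (Suc m) z y \<in> unit_sphere (Suc m)"
proof -
  have "1 - z\<^sup>2 \<ge> 0" using assms(1) by (simp add: abs_square_le_1)
  moreover have "(\<Sum>i<m. (y i)\<^sup>2) = 1"
    using assms(2) by (simp add: unit_sphere_def L2_set_def)
  moreover have "(\<Sum>i<Suc m. (lift_point (Suc m) z y i)\<^sup>2) = z\<^sup>2 + (\<Sum>i<m. (sqrt (1 - z\<^sup>2) * y i)\<^sup>2)"
    by (simp only: sum.lessThan_Suc_shift) simp
  ultimately have "(\<Sum>i<Suc m. (lift_point (Suc m) z y i)\<^sup>2) = 1"
    by (simp add: power_mult_distrib sum_distrib_left [symmetric])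
  then show ?thesis
    by (simp add: unit_sphere_def L2_set_def lift_point_def)
qed

text \<open>For \<open>z = 1\<close> or \<open>z = -1\<close> all \<open>y\<close> collapse to a
  pole; \<open>\<bar>z\<bar> < 1\<close> keeps the factor \<open>sqrt (1 - z\<^sup>2)\<close>
  nonzero.\<close>

lemma lift_point_inject:
  assumes eq: "lift_point (Suc m) z y = lift_point (Suc m) z' y'"
    and z: "\<bar>z\<bar> < 1" and y: "y \<in> extensional {..<m}" "y' \<in> extensional {..<m}"
  shows "z = z' \<and> y = y'"
proof
  show z': "z = z'" using fun_cong [OF eq, of 0] by simp
  have "z\<^sup>2 \<noteq> 1" using z abs_square_less_1 [of z] by simp
  show "y = y'"
  proof (rule extensionalityI [OF y])
    fix i assume "i \<in> {..<m}"
    then show "y i = y' i"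
      using fun_cong [OF eq, of "Suc i"] z' \<open>z\<^sup>2 \<noteq> 1\<close> by simp
  qed
qed

lemma lift_point_monomial:
  "(\<Prod>i<Suc m. lift_point (Suc m) z y i ^ a i) =
    z ^ a 0 * sqrt (1 - z\<^sup>2) ^ (\<Sum>i<m. a (Suc i)) * (\<Prod>i<m. y i ^ a (Suc i))"
  unfolding prod.lessThan_Suc_shift by (simp add: power_mult_distrib prod.distrib power_sum mult.assoc)

lemma gauss_jacobi_even_monomial:
  fixes \<beta> :: real
  assumes \<beta>: "\<beta> > -1" and N: "N > 0" and even: "even e" and deg: "k + e \<le> 2 * N - 1"
  shows "(\<Sum>z\<in>gauss_jacobi_nodes N \<beta>. gauss_jacobi_weight N \<beta> z * (z ^ k * sqrt (1 - z\<^sup>2) ^ e)) =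
    (LBINT s:{-1..1}. s ^ k * (1 - s\<^sup>2) powr (real e / 2 + \<beta>))"
proof -
  obtain f where e: "e = 2 * f" using even by (elim evenE)
  define p where "p = monom 1 k * [:1, 0, -1 :: real:] ^ f"
  have p: "poly p s = s ^ k * (1 - s\<^sup>2) ^ f" for s
    by (simp add: p_def poly_monom power2_eq_square)
  have "degree p \<le> degree (monom (1 :: real) k) + degree [:1, 0, -1 :: real:] * f"
    unfolding p_def by (intro order_trans [OF degree_mult_le] add_mono degree_power_le order_refl)
  also have "\<dots> \<le> 2 * N - 1" using deg by (simp add: degree_monom_eq e)
  finally have degp: "degree p \<le> 2 * N - 1" .
  have nonneg: "1 - s\<^sup>2 \<ge> 0" if "s \<in> {-1..1}" for s :: real
    using that by (simp add: abs_square_le_1 abs_le_iff)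
  have "(\<Sum>z\<in>gauss_jacobi_nodes N \<beta>. gauss_jacobi_weight N \<beta> z * (z ^ k * sqrt (1 - z\<^sup>2) ^ e)) =
      (\<Sum>z\<in>gauss_jacobi_nodes N \<beta>. gauss_jacobi_weight N \<beta> z * poly p z)"
  proof (intro sum.cong refl)
    fix z assume "z \<in> gauss_jacobi_nodes N \<beta>"
    then have "z \<in> {-1..1}" using gauss_jacobi_nodes_subset [OF \<beta>, of N] by auto
    then show "gauss_jacobi_weight N \<beta> z * (z ^ k * sqrt (1 - z\<^sup>2) ^ e) = gauss_jacobi_weight N \<beta> z * poly p z"
      using nonneg [of z] by (simp add: p e power_mult)
  qed
  also have "\<dots> = (LBINT s:{-1..1}. poly p s * (1 - s\<^sup>2) powr \<beta>)"
    using gauss_jacobi_quadrature [OF \<beta> N degp] by simp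
  also have "\<dots> = (LBINT s:{-1..1}. s ^ k * (1 - s\<^sup>2) powr (real e / 2 + \<beta>))"
  proof (rule set_lebesgue_integral_cong)
    show "\<forall>s. s \<in> {-1..1} \<longrightarrow> poly p s * (1 - s\<^sup>2) powr \<beta> = s ^ k * (1 - s\<^sup>2) powr (real e / 2 + \<beta>)"
    proof (intro allI impI)
      fix s :: real assume "s \<in> {-1..1}"
      \<comment> \<open>At the endpoints both sides are 0, because \<open>0 powr x = 0\<close> for
        every \<open>x\<close>.\<close>
      then show "poly p s * (1 - s\<^sup>2) powr \<beta> = s ^ k * (1 - s\<^sup>2) powr (real e / 2 + \<beta>)"
        using nonneg [of s] by (cases "1 - s\<^sup>2 = 0") (simp_all add: p e powr_add powr_realpow)
    qed
  qed simp
  finally show ?thesis .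
qed

lemma product_rule_two:
  shows "product_nodes t 2 = polygon_vertices (2 * (t + 1))"
    and "product_weight t 2 x = pi / real (t + 1)"
  by (simp_all add: product_nodes.simps product_weight.simps)

text \<open>The weight \<open>pi / (t + 1)\<close> turns the factor \<open>K / pi\<close> of
  \<open>polygon_sum_eq\<close> into the 2 of \<open>sphere_moment\<close>, and the degree bound is
  its condition \<open>a + b < K\<close> for \<open>K = 2 * (t + 1)\<close>.\<close>

lemma polygon_rule_monomial:
  assumes "(\<Sum>i<2. a i) \<le> 2 * t + 1"
  shows "(\<Sum>x\<in>product_nodes t 2. product_weight t 2 x * (\<Prod>i<2. x i ^ a i)) = sphere_moment 2 a"
proof -
  have two: "{..<2} = {0, 1 :: nat}" by auto
  have "(\<Sum>x\<in>product_nodes t 2. product_weight t 2 x * (\<Prod>i<2. x i ^ a i)) =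
      pi / real (t + 1) * polygon_sum (2 * (t + 1)) (a 0) (a 1)"
    unfolding product_rule_two two polygon_vertices_sum [symmetric] by (simp add: sum_distrib_left)
  also have "polygon_sum (2 * (t + 1)) (a 0) (a 1) = real (2 * (t + 1)) / pi *
      (gaussian_moment (a 0) * gaussian_moment (a 1) / Gamma (real (a 0 + a 1 + 2) / 2))"
    using assms by (intro polygon_sum_eq) (simp add: two)
  also have "pi / real (t + 1) * (real (2 * (t + 1)) / pi * x) = 2 * x" for x
    unfolding of_nat_mult by (simp del: of_nat_Suc of_nat_add)
  also have "2 * (gaussian_moment (a 0) * gaussian_moment (a 1) / Gamma (real (a 0 + a 1 + 2) / 2)) = sphere_moment 2 a"
    unfolding sphere_moment_def two by (simp add: add_ac)
  finally show ?thesis .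
qed

section \<open>The step from one dimension to the next\<close>

context
  fixes m t :: nat
  assumes m: "m \<ge> 2" and sub: "product_nodes t m \<subseteq> unit_sphere m"
begin

private abbreviation "\<beta> \<equiv> (real (Suc m) - 3) / 2"
private abbreviation "Z \<equiv> gauss_jacobi_nodes (t + 1) \<beta>"

private lemma beta_gt: "\<beta> > -1"
  using m by simp

private lemma nodes_abs:
  assumes "z \<in> Z"
  shows "\<bar>z\<bar> < 1"
proof -
  have "z \<in> {-1<..<1}" using gauss_jacobi_nodes_subset [OF beta_gt] assms by blast
  then show ?thesis by (simp add: abs_less_iff)
qed

private lemma ext: "y \<in> product_nodes t m \<Longrightarrow> y \<in> extensional {..<m}"
  using sub by (auto simp: unit_sphere_def PiE_def)

lemma product_nodes_Suc:
  "product_nodes t (Suc m) = (\<lambda>(z, y). lift_point (Suc m) z y) ` (Z \<times> product_nodes t m)"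
  using m by (subst product_nodes.simps) auto

lemma inj_on_lift_point: "inj_on (\<lambda>(z, y). lift_point (Suc m) z y) (Z \<times> product_nodes t m)"
  by (rule inj_onI) (auto dest!: lift_point_inject simp: nodes_abs ext)

text \<open>Injectivity of the lift leaves a single decomposition of the point, so the definite
  description has exactly one candidate.\<close>

lemma product_weight_Suc:
  assumes "z \<in> Z" "y \<in> product_nodes t m"
  shows "product_weight t (Suc m) (lift_point (Suc m) z y) = gauss_jacobi_weight (t + 1) \<beta> z * product_weight t m y"
proof -
  have "(THE w. \<exists>z'\<in>Z. \<exists>y'\<in>product_nodes t m. lift_point (Suc m) z y = lift_point (Suc m) z' y' \<and>
      w = gauss_jacobi_weight (t + 1) \<beta> z' * product_weight t m y') =
      gauss_jacobi_weight (t + 1) \<beta> z * product_weight t m y"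
  proof (rule the_equality)
    fix w assume "\<exists>z'\<in>Z. \<exists>y'\<in>product_nodes t m. lift_point (Suc m) z y = lift_point (Suc m) z' y' \<and>
      w = gauss_jacobi_weight (t + 1) \<beta> z' * product_weight t m y'"
    then show "w = gauss_jacobi_weight (t + 1) \<beta> z * product_weight t m y"
      using lift_point_inject [of m z y] nodes_abs ext assms by blast
  qed (use assms in blast)
  then show ?thesis
    using m by (subst product_weight.simps) simp
qed

lemma product_nodes_Suc_subset: "product_nodes t (Suc m) \<subseteq> unit_sphere (Suc m)"
  unfolding product_nodes_Suc
  using lift_point_in_unit_sphere [OF less_imp_le [OF nodes_abs] subsetD [OF sub]] by auto

lemma finite_product_nodes_Suc: "finite (product_nodes t m) \<Longrightarrow> finite (product_nodes t (Suc m))"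
  unfolding product_nodes_Suc using finite_gauss_jacobi_nodes [OF beta_gt] by simp

lemma card_product_nodes_Suc: "card (product_nodes t (Suc m)) = (t + 1) * card (product_nodes t m)"
  unfolding product_nodes_Suc
  by (subst card_image [OF inj_on_lift_point]) (simp only: card_cartesian_product card_gauss_jacobi_nodes [OF beta_gt])

lemma product_weight_Suc_pos:
  assumes "\<And>y. y \<in> product_nodes t m \<Longrightarrow> product_weight t m y > 0" "x \<in> product_nodes t (Suc m)"
  shows "product_weight t (Suc m) x > 0"
proof -
  obtain z y where zy: "z \<in> Z" "y \<in> product_nodes t m" and x: "x = lift_point (Suc m) z y"
    using assms(2) unfolding product_nodes_Suc by auto
  have "gauss_jacobi_weight (t + 1) \<beta> z > 0"
    using zy(1) by (intro gauss_jacobi_weight_pos beta_gt) simp_all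
  with assms(1) [OF zy(2)] show ?thesis
    unfolding x product_weight_Suc [OF zy] by (intro mult_pos_pos)
qed

text \<open>The sum over lifted points splits into a Gauss-Jacobi sum times a sum over the lower
  sphere, parallel to the factorisation in \<open>sphere_moment_Suc\<close>.\<close>

lemma product_rule_monomial_Suc:
  assumes exact: "\<And>a. (\<Sum>i<m. a i) \<le> 2 * t + 1 \<Longrightarrow>
      (\<Sum>y\<in>product_nodes t m. product_weight t m y * (\<Prod>i<m. y i ^ a i)) = sphere_moment m a"
    and a: "(\<Sum>i<Suc m. a i) \<le> 2 * t + 1"
  shows "(\<Sum>x\<in>product_nodes t (Suc m). product_weight t (Suc m) x * (\<Prod>i<Suc m. x i ^ a i)) = sphere_moment (Suc m) a"
proof -
  define e where "e = (\<Sum>i<m. a (Suc i))"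
  have ae: "a 0 + e \<le> 2 * t + 1"
    using a unfolding e_def by (simp only: sum.lessThan_Suc_shift)
  let ?w = "gauss_jacobi_weight (t + 1) \<beta>"
  have "(\<Sum>x\<in>product_nodes t (Suc m). product_weight t (Suc m) x * (\<Prod>i<Suc m. x i ^ a i)) =
      (\<Sum>(z, y)\<in>Z \<times> product_nodes t m. (?w z * (z ^ a 0 * sqrt (1 - z\<^sup>2) ^ e)) *
         (product_weight t m y * (\<Prod>i<m. y i ^ a (Suc i))))"
    unfolding product_nodes_Suc
    by (subst sum.reindex [OF inj_on_lift_point], intro sum.cong refl)
       (auto simp: product_weight_Suc lift_point_monomial e_def simp del: prod.lessThan_Suc)
  also have "\<dots> = (\<Sum>z\<in>Z. ?w z * (z ^ a 0 * sqrt (1 - z\<^sup>2) ^ e)) *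
      (\<Sum>y\<in>product_nodes t m. product_weight t m y * (\<Prod>i<m. y i ^ a (Suc i)))"
    by (simp only: sum.cartesian_product [symmetric] sum_product)
  also have "(\<Sum>y\<in>product_nodes t m. product_weight t m y * (\<Prod>i<m. y i ^ a (Suc i))) =
      sphere_moment m (\<lambda>i. a (Suc i))"
    using ae by (intro exact) (simp add: e_def)
  also have "(\<Sum>z\<in>Z. ?w z * (z ^ a 0 * sqrt (1 - z\<^sup>2) ^ e)) * \<dots> = sphere_moment (Suc m) a"
  proof (cases "even e")
    case True
    have "(\<Sum>z\<in>Z. ?w z * (z ^ a 0 * sqrt (1 - z\<^sup>2) ^ e)) =
        (LBINT s:{-1..1}. s ^ a 0 * (1 - s\<^sup>2) powr (real e / 2 + \<beta>))"
      using ae by (intro gauss_jacobi_even_monomial beta_gt True) auto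
    then show ?thesis
      using m sphere_moment_Suc [of m a] by (simp add: e_def)
  next
    case False
    then have "sphere_moment m (\<lambda>i. a (Suc i)) = 0"
      unfolding e_def by (rule sphere_moment_odd)
    then show ?thesis
      using m sphere_moment_Suc [of m a] by simp
  qed
  finally show ?thesis .
qed

end

lemma product_rule:
  assumes "m \<ge> 2"
  shows "product_nodes t m \<subseteq> unit_sphere m \<and> finite (product_nodes t m) \<and>
    card (product_nodes t m) = 2 * (t + 1) ^ (m - 1) \<and>
    (\<forall>x\<in>product_nodes t m. product_weight t m x > 0) \<and>
    (\<forall>a. (\<Sum>i<m. a i) \<le> 2 * t + 1 \<longrightarrow>
      (\<Sum>x\<in>product_nodes t m. product_weight t m x * (\<Prod>i<m. x i ^ a i)) = sphere_moment m a)"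
  using assms
proof (induction m rule: nat_induct_at_least)
  case base
  have "finite (polygon_vertices (2 * (t + 1)))"
    by (simp add: polygon_vertices_def)
  moreover have "pi / real (t + 1) > 0" by simp
  ultimately show ?case
    using polygon_vertices_subset [of "2 * (t + 1)"] polygon_rule_monomial [of _ t] card_polygon_vertices [of "2 * (t + 1)"]
    unfolding product_rule_two by simp
next
  case (Suc m)
  then have sub: "product_nodes t m \<subseteq> unit_sphere m"
    and fin: "finite (product_nodes t m)"
    and card: "card (product_nodes t m) = 2 * (t + 1) ^ (m - 1)"
    and pos: "\<And>y. y \<in> product_nodes t m \<Longrightarrow> product_weight t m y > 0"
    and exact: "\<And>a. (\<Sum>i<m. a i) \<le> 2 * t + 1 \<Longrightarrow>
      (\<Sum>y\<in>product_nodes t m. product_weight t m y * (\<Prod>i<m. y i ^ a i)) = sphere_moment m a"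
    by blast+
  have "card (product_nodes t (Suc m)) = 2 * (t + 1) ^ (Suc m - 1)"
    using Suc.hyps unfolding card_product_nodes_Suc [OF Suc.hyps sub] card
    by (cases m) auto
  moreover have "\<forall>x\<in>product_nodes t (Suc m). product_weight t (Suc m) x > 0"
    using product_weight_Suc_pos [OF Suc.hyps sub pos] by (rule ballI)
  moreover have "\<forall>a. (\<Sum>i<Suc m. a i) \<le> 2 * t + 1 \<longrightarrow>
      (\<Sum>x\<in>product_nodes t (Suc m). product_weight t (Suc m) x * (\<Prod>i<Suc m. x i ^ a i)) = sphere_moment (Suc m) a"
    using product_rule_monomial_Suc [OF Suc.hyps sub exact] by (intro allI impI)
  ultimately show ?case
    using product_nodes_Suc_subset [OF Suc.hyps sub] finite_product_nodes_Suc [OF Suc.hyps sub fin]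
    by (intro conjI)
qed

theorem corollary2p3:
  fixes n t :: nat
  assumes "n \<ge> 2" and "t > 0"
  shows "cubature_rule n (2 * t) (product_nodes t n) (product_weight t n) \<and>
         card (product_nodes t n) = 2 * (t + 1) ^ (n - 1)"
proof -
  let ?X = "product_nodes t n" and ?W = "product_weight t n"
  note rule = product_rule [OF assms(1), of t]
  have "(\<integral>x. f x \<partial>sphere_area n) = (\<Sum>x\<in>?X. ?W x * f x)"
    if hom: "homogeneous_polynomial n (2 * t) f" for f
  proof -
    let ?A = "{a \<in> {..<n} \<rightarrow>\<^sub>E {..2 * t}. (\<Sum>i<n. a i) = 2 * t}"
    obtain c where "\<forall>x. f x = (\<Sum>a\<in>?A. c a * (\<Prod>i<n. x i ^ a i))"
      using hom unfolding homogeneous_polynomial_def by blast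
    then have f: "f = (\<lambda>x. \<Sum>a\<in>?A. c a * (\<Prod>i<n. x i ^ a i))"
      by (intro ext) blast
    have "(\<integral>x. f x \<partial>sphere_area n) = (\<Sum>a\<in>?A. c a * sphere_moment n a)"
      unfolding f using assms(1)
      by (subst Bochner_Integration.integral_sum)
         (auto simp: integrable_sphere_monomial integral_sphere_monomial)
    also have "\<dots> = (\<Sum>a\<in>?A. c a * (\<Sum>x\<in>?X. ?W x * (\<Prod>i<n. x i ^ a i)))"
      using rule by (intro sum.cong refl) simp
    also have "\<dots> = (\<Sum>a\<in>?A. \<Sum>x\<in>?X. ?W x * (c a * (\<Prod>i<n. x i ^ a i)))"
      unfolding sum_distrib_left by (simp only: mult.left_commute)
    also have "\<dots> = (\<Sum>x\<in>?X. \<Sum>a\<in>?A. ?W x * (c a * (\<Prod>i<n. x i ^ a i)))"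
      by (rule sum.swap)
    also have "\<dots> = (\<Sum>x\<in>?X. ?W x * f x)"
      unfolding f sum_distrib_left ..
    finally show ?thesis .
  qed
  with rule show ?thesis unfolding cubature_rule_def by blast
qed

end
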